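(* Let $\varphi,\psi\in L^1_\alpha(\mathbb R^{d+1}_+)\cap L^\infty_\alpha(\mathbb R^{d+1}_+)$ and $\sigma\in L^1_\alpha(\mathcal X)$. Then the two-wavelet localization operator $$\mathcal L_{\varphi,\psi}(\sigma):L^p_\alpha(\mathbb R^{d+1}_+)\longrightarrow L^p_\alpha(\mathbb R^{d+1}_+)$$ is compact for all $p\in[1,\infty]$.
   Context: Fix an integer $d\ge 1$ and a real $\alpha>-1/2$. Let $\mathbb R^{d+1}_+=\mathbb R^d\times(0,\infty)$, with points $x=(x',x_{d+1})$, equipped with the measure $$d\mu_\alpha(x)=\frac{x_{d+1}^{2\alpha+1}}{(2\pi)^d2^{2\alpha}\Gamma^2(\alpha+1)}\,dx.$$ For $1\le p\le\infty$, $L^p_\alpha(\mathbb R^{d+1}_+)$ is the $L^p$ space of complex-valued functions for $\mu_\alpha$, with norm $\|\cdot\|_{\alpha,p}$. Let $\mathcal X=\{(a,x): a>0,\ x\in\mathbb R^{d+1}_+\}$ with measure $d\mu_\alpha(a,x)=\frac{d\mu_\alpha(x)\,da}{a^{2\alpha+d+3}}$, and $L^p_\alpha(\mathcal X)$ the corresponding $L^p$ space. Generalized translation, for $x,y\in\mathbb R^{d+1}_+$: $$\tau^\alpha_x\varphi(y)=\frac{\Gamma(\alpha+1)}{\sqrt\pi\,\Gamma(\alpha+1/2)}\int_0^\pi\varphi\Big(x'+y',\sqrt{x_{d+1}^2+y_{d+1}^2+2x_{d+1}y_{d+1}\cos\theta}\Big)(\sin\theta)^{2\alpha}\,d\theta;$$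 it extends to a contraction on every $L^p_\alpha(\mathbb R^{d+1}_+)$. For $a>0$ put $\varphi_a(x)=a^{-(2\alpha+d+2)}\varphi(x/a)$ and $\varphi_{a,x}(y)=a^{\alpha+1+\frac d2}\,\tau^\alpha_x\varphi_a(y)$. Weinstein continuous wavelet transform (for $f$ and $\varphi$ in Lebesgue spaces with conjugate exponents): $$\Phi^W_\varphi(f)(a,x)=\int_{\mathbb R^{d+1}_+}f(y)\,\overline{\varphi_{a,x}(y)}\,d\mu_\alpha(y),\quad (a,x)\in\mathcal X.$$ Two-wavelet localization operator with symbol $\sigma$ (measurable on $\mathcal X$) and windows $\varphi,\psi$ (measurable on $\mathbb R^{d+1}_+$): $$\mathcal L_{\varphi,\psi}(\sigma)(f)(y)=\int_{\mathcal X}\sigma(a,x)\,\Phi^W_\varphi(f)(a,x)\,\psi_{a,x}(y)\,d\mu_\alpha(a,x),\quad y\in\mathbb R^{d+1}_+.$$ *)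

theory Defs
  imports "HOL-Probability.Essential_Supremum" "HOL-Analysis.Analysis"
begin

section \<open>\<open>L\<^sup>p\<close> spaces and compact operators\<close>

text \<open>
  \<open>L\<^sup>p\<close> is represented by actual measurable functions, with the seminorm \<open>Lp_norm\<close> whose kernel
  is almost-everywhere equality.  The exponent ranges over \<open>[1, \<infinity>]\<close> inside \<^typ>\<open>ennreal\<close>.
\<close>

definition Lp_space :: "'a measure \<Rightarrow> ennreal \<Rightarrow> ('a \<Rightarrow> complex) set" where
  "Lp_space M p = {f \<in> borel_measurable M.
     if p = \<infinity> then esssup M (\<lambda>x. ennreal (norm (f x))) < \<infinity>
     else integrable M (\<lambda>x. norm (f x) powr enn2real p)}"

definition Lp_norm :: "'a measure \<Rightarrow> ennreal \<Rightarrow> ('a \<Rightarrow> complex) \<Rightarrow> real" where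
  "Lp_norm M p f =
     (if p = \<infinity> then enn2real (esssup M (\<lambda>x. ennreal (norm (f x))))
      else (\<integral>x. norm (f x) powr enn2real p \<partial>M) powr (1 / enn2real p))"

text \<open>
  A map on functions that induces a linear operator on the quotient of \<^const>\<open>Lp_space\<close> by
  almost-everywhere equality.
\<close>

definition linear_operator_Lp ::
  "'a measure \<Rightarrow> ennreal \<Rightarrow> (('a \<Rightarrow> complex) \<Rightarrow> 'a \<Rightarrow> complex) \<Rightarrow> bool" where
  "linear_operator_Lp M p T \<longleftrightarrow>
     (\<forall>f\<in>Lp_space M p. T f \<in> Lp_space M p) \<and>
     (\<forall>f\<in>Lp_space M p. \<forall>g\<in>Lp_space M p.
        (AE x in M. f x = g x) \<longrightarrow> (AE x in M. T f x = T g x)) \<and>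
     (\<forall>f\<in>Lp_space M p. \<forall>g\<in>Lp_space M p.
        AE x in M. T (\<lambda>z. f z + g z) x = T f x + T g x) \<and>
     (\<forall>f\<in>Lp_space M p. \<forall>c. AE x in M. T (\<lambda>z. c * f z) x = c * T f x)"

text \<open>
  Compactness: every bounded sequence has a subsequence whose image converges in \<open>L\<^sup>p\<close>.
  Boundedness of \<open>T\<close> is a consequence.
\<close>

definition compact_operator_Lp ::
  "'a measure \<Rightarrow> ennreal \<Rightarrow> (('a \<Rightarrow> complex) \<Rightarrow> 'a \<Rightarrow> complex) \<Rightarrow> bool" where
  "compact_operator_Lp M p T \<longleftrightarrow>
     linear_operator_Lp M p T \<and>
     (\<forall>F C. (\<forall>n::nat. F n \<in> Lp_space M p \<and> Lp_norm M p (F n) \<le> C) \<longrightarrow>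
        (\<exists>r g. strict_mono r \<and> g \<in> Lp_space M p \<and>
           (\<lambda>n. Lp_norm M p (\<lambda>x. T (F (r n)) x - g x)) \<longlonglongrightarrow> 0))"

section \<open>The Weinstein setting\<close>

text \<open>
  A point \<open>x = (x', x\<^bsub>d+1\<^esub>)\<close> of \<open>\<real>\<^bsup>d+1\<^esup>\<close> is a pair in \<^typ>\<open>(real ^ 'd) \<times> real\<close>, with
  \<open>d = CARD('d) \<ge> 1\<close>.  Measurability is Borel measurability on the open upper half-space; values of
  functions off the half-space never matter.
\<close>

definition upper_half_space :: "((real ^ 'd) \<times> real) set" where
  "upper_half_space = {x. snd x > 0}"

definition weinstein_measure :: "real \<Rightarrow> ((real ^ 'd) \<times> real) measure" where
  "weinstein_measure \<alpha> =
     density (restrict_space lborel upper_half_space)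
       (\<lambda>x. ennreal (snd x powr (2 * \<alpha> + 1) /
          ((2 * pi) ^ CARD('d) * 2 powr (2 * \<alpha>) * (Gamma (\<alpha> + 1))\<^sup>2)))"

text \<open>The measure \<open>d\<mu>\<^sub>\<alpha>(a, x)\<close> on \<open>\<X> = (0, \<infinity>) \<times> \<real>\<^bsup>d+1\<^esup>\<^sub>+\<close>.\<close>

definition weinstein_measure_X :: "real \<Rightarrow> (real \<times> ((real ^ 'd) \<times> real)) measure" where
  "weinstein_measure_X \<alpha> =
     density (restrict_space lborel {0<..} \<Otimes>\<^sub>M weinstein_measure \<alpha>)
       (\<lambda>(a, x). ennreal (1 / a powr (2 * \<alpha> + real CARD('d) + 3)))"

text \<open>
  For \<open>\<phi> \<in> L\<^sup>p\<close> and fixed \<open>x\<close> the integral exists for almost every \<open>y\<close>; on the exceptional null set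
  the translate takes the default value \<open>0\<close>.
\<close>

definition gen_translation ::
  "real \<Rightarrow> (real ^ 'd) \<times> real \<Rightarrow> ((real ^ 'd) \<times> real \<Rightarrow> complex) \<Rightarrow> (real ^ 'd) \<times> real \<Rightarrow> complex"
where
  "gen_translation \<alpha> x \<phi> y =
     (Gamma (\<alpha> + 1) / (sqrt pi * Gamma (\<alpha> + 1/2))) *\<^sub>R
     (LBINT \<theta>=0..pi. (sin \<theta> powr (2 * \<alpha>)) *\<^sub>R
        \<phi> (fst x + fst y, sqrt ((snd x)\<^sup>2 + (snd y)\<^sup>2 + 2 * snd x * snd y * cos \<theta>)))"

definition dilation ::
  "real \<Rightarrow> real \<Rightarrow> ((real ^ 'd) \<times> real \<Rightarrow> complex) \<Rightarrow> (real ^ 'd) \<times> real \<Rightarrow> complex" where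
  "dilation \<alpha> a \<phi> x = (a powr - (2 * \<alpha> + real CARD('d) + 2)) *\<^sub>R \<phi> (x /\<^sub>R a)"

text \<open>The family \<open>\<phi>\<^bsub>a,x\<^esub>\<close>.\<close>

definition wavelet ::
  "real \<Rightarrow> ((real ^ 'd) \<times> real \<Rightarrow> complex) \<Rightarrow> real \<Rightarrow> (real ^ 'd) \<times> real \<Rightarrow>
     (real ^ 'd) \<times> real \<Rightarrow> complex" where
  "wavelet \<alpha> \<phi> a x y =
     (a powr (\<alpha> + 1 + real CARD('d) / 2)) *\<^sub>R gen_translation \<alpha> x (dilation \<alpha> a \<phi>) y"

definition wavelet_transform ::
  "real \<Rightarrow> ((real ^ 'd) \<times> real \<Rightarrow> complex) \<Rightarrow> ((real ^ 'd) \<times> real \<Rightarrow> complex) \<Rightarrow>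
     real \<times> ((real ^ 'd) \<times> real) \<Rightarrow> complex" where
  "wavelet_transform \<alpha> \<phi> f =
     (\<lambda>(a, x). \<integral>y. f y * cnj (wavelet \<alpha> \<phi> a x y) \<partial>weinstein_measure \<alpha>)"

definition localization_operator ::
  "real \<Rightarrow> ((real ^ 'd) \<times> real \<Rightarrow> complex) \<Rightarrow> ((real ^ 'd) \<times> real \<Rightarrow> complex) \<Rightarrow>
     (real \<times> ((real ^ 'd) \<times> real) \<Rightarrow> complex) \<Rightarrow>
     ((real ^ 'd) \<times> real \<Rightarrow> complex) \<Rightarrow> (real ^ 'd) \<times> real \<Rightarrow> complex" where
  "localization_operator \<alpha> \<phi> \<psi> \<sigma> f y =
     (\<integral>(a, x). \<sigma> (a, x) * wavelet_transform \<alpha> \<phi> f (a, x) * wavelet \<alpha> \<psi> a x y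
        \<partial>weinstein_measure_X \<alpha>)"

end

theory Submission
  imports Defs "HOL-Complex_Analysis.Great_Picard"
begin

text \<open>
  The operator is an average of the rank-one operators \<open>f \<mapsto> \<langle>f, \<phi>\<^bsub>a,x\<^esub>\<rangle> \<psi>\<^bsub>a,x\<^esub>\<close> against the integrable
  weight \<open>\<sigma>\<close>, and these have uniformly bounded norm on \<open>L\<^sup>p\<close>.  Put \<open>A = a\<^bsup>D/2\<^esup>\<close> with
  \<open>D = 2\<alpha> + d + 2\<close>, the homogeneous dimension of \<open>\<mu>\<^sub>\<alpha>\<close>.  The wavelets satisfy
  \<open>\<parallel>\<phi>\<^bsub>a,x\<^esub>\<parallel>\<^sub>1 \<le> B A\<close> and \<open>\<bar>\<phi>\<^bsub>a,x\<^esub>\<bar> \<le> B / A\<close> almost everywhere, and likewise for \<open>\<psi>\<close>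
  (\<open>wavelet_bounds\<close>).  Interpolating between these two bounds gives
  \<open>\<bar>\<langle>f, \<phi>\<^bsub>a,x\<^esub>\<rangle>\<bar> \<le> c A\<^bsup>1-2/p\<^esup>\<close> for \<open>f\<close> in a ball of \<open>L\<^sup>p\<close>, and \<open>\<parallel>\<psi>\<^bsub>a,x\<^esub>\<parallel>\<^sub>p \<le> c A\<^bsup>2/p-1\<^esup>\<close>; the
  powers of \<open>A\<close> cancel.

  Compactness comes from weak compactness and dominated convergence, through the fact that a
  sequence bounded in \<open>L\<^sup>\<infinity>\<close> has a subsequence whose
  pairings with every integrable function converge (\<open>weakly_convergent_subsequence\<close>).
  For \<open>p < \<infinity>\<close> it is applied on the parameter space \<open>\<X>\<close> to the rescaled transforms
  \<open>A\<^bsup>2/p-1\<^esup> \<langle>F\<^sub>n, \<phi>\<^bsub>a,x\<^esub>\<rangle>\<close>.  For almost every \<open>y\<close> the function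
  \<open>\<sigma> A\<^bsup>1-2/p\<^esup> \<psi>\<^bsub>a,x\<^esub>(y)\<close> is integrable over \<open>\<X>\<close>, so the images converge at \<open>y\<close>, and a fixed
  function of \<open>L\<^sup>p\<close> dominates them (\<open>synthesis_dominated\<close>).
  For \<open>p = \<infinity>\<close> that domination no longer gives convergence in norm, and the subsequence is chosen
  on the half-space, for the \<open>F\<^sub>n\<close> themselves: each \<open>\<phi>\<^bsub>a,x\<^esub>\<close> is integrable, so all the
  transforms converge, and dominated convergence over \<open>\<X>\<close> makes the images converge uniformly in \<open>y\<close>, up to null sets.
  All of this uses only the two bounds on the windows and is carried out for abstract families.

  The wavelet bounds reduce to the fact that the generalized translate of a function \<open>u \<ge> 0\<close> has
  integral proportional to \<open>\<integral>u d\<mu>\<^sub>\<alpha>\<close>.  In the last variable, \<open>(t, \<theta>)\<close> are polar coordinates of a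
  point of a half-plane that carries a power of the height as its density; the argument
  \<open>sqrt (s\<^sup>2 + t\<^sup>2 + 2 s t cos \<theta>)\<close> is the norm of that point after a horizontal shift by \<open>s\<close>, and
  the density is invariant under horizontal shifts (\<open>nn_integral_bessel_translation\<close>).
\<close>

section \<open>Weak sequential compactness of bounded sequences\<close>

text \<open>
  Separability of \<open>L\<^sup>1\<close> enters only through this condition on the \<open>\<sigma>\<close>-algebra: convergence has to
  be arranged, by a diagonal argument, on countably many sets.
\<close>
definition countably_generated :: "'a measure \<Rightarrow> bool" where
  "countably_generated M \<longleftrightarrow>
     (\<exists>G. countable G \<and> G \<subseteq> Pow (space M) \<and> sets M = sigma_sets (space M) G)"

text \<open>
  Closing a countable generator under finite intersections keeps it countable and makes Dynkin's
  theorem available.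
\<close>
lemma countably_generated_Int_stable:
  assumes "countably_generated M"
  obtains G where "countable G" "Int_stable G" "G \<subseteq> sets M" "space M \<in> G"
    "sets M = sigma_sets (space M) G"
proof -
  obtain G where G: "countable G" "G \<subseteq> Pow (space M)" "sets M = sigma_sets (space M) G"
    using assms by (auto simp: countably_generated_def)
  define H where "H = (\<lambda>F. space M \<inter> \<Inter>F) ` {F. finite F \<and> F \<subseteq> G}"
  have "countable H"
    unfolding H_def using countable_Collect_finite_subset[OF G(1)] by simp
  moreover have "Int_stable H"
  proof (rule Int_stableI)
    fix a b assume "a \<in> H" "b \<in> H"
    then obtain E F where "finite E" "E \<subseteq> G" "a = space M \<inter> \<Inter>E"
      "finite F" "F \<subseteq> G" "b = space M \<inter> \<Inter>F"
      unfolding H_def by auto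
    then have "a \<inter> b = space M \<inter> \<Inter>(E \<union> F)" "finite (E \<union> F)" "E \<union> F \<subseteq> G" by auto
    then show "a \<inter> b \<in> H" unfolding H_def by blast
  qed
  moreover have H_sets: "H \<subseteq> sets M"
  proof
    fix a assume "a \<in> H"
    then obtain F where F: "finite F" "F \<subseteq> G" "a = space M \<inter> \<Inter>F" unfolding H_def by auto
    have "F \<subseteq> sets M" using F(2) G(3) by auto
    with F(1) have "space M \<inter> \<Inter>F \<in> sets M"
    proof (induction F)
      case (insert b F)
      then have "b \<in> sets M" "space M \<inter> \<Inter>F \<in> sets M" by simp_all
      then have "b \<inter> (space M \<inter> \<Inter>F) \<in> sets M" by (rule sets.Int)
      moreover have "space M \<inter> \<Inter>(insert b F) = b \<inter> (space M \<inter> \<Inter>F)" by auto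
      ultimately show ?case by (simp only:)
    qed simp
    then show "a \<in> sets M" using F(3) by simp
  qed
  moreover have "space M \<in> H"
    unfolding H_def by (rule image_eqI[of _ _ "{}"]) auto
  moreover have "sets M = sigma_sets (space M) H"
  proof
    have "G \<subseteq> H"
    proof
      fix a assume "a \<in> G"
      then have "a = space M \<inter> \<Inter>{a}" using G(2) by auto
      then show "a \<in> H" unfolding H_def using \<open>a \<in> G\<close> by blast
    qed
    then show "sets M \<subseteq> sigma_sets (space M) H"
      unfolding G(3) by (rule sigma_sets_mono')
    show "sigma_sets (space M) H \<subseteq> sets M"
      using H_sets by (rule sets.sigma_sets_subset)
  qed
  ultimately show ?thesis using that by blast
qed

lemma countably_generated_sets_cong:
  "sets M = sets N \<Longrightarrow> countably_generated M \<longleftrightarrow> countably_generated N"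
  using sets_eq_imp_space_eq[of M N] by (simp add: countably_generated_def)

lemma countably_generated_borel:
  "countably_generated (borel :: 'a::second_countable_topology measure)"
proof -
  obtain B :: "'a set set" where B: "countable B" "topological_basis B"
    using ex_countable_basis by auto
  have "sets (borel :: 'a measure) = sigma_sets UNIV B"
    by (subst borel_eq_countable_basis[OF B]) simp
  with B show ?thesis by (auto simp: countably_generated_def)
qed

lemma countably_generated_restrict_space:
  assumes "countably_generated M"
  shows "countably_generated (restrict_space M S)"
proof -
  obtain G where G: "countable G" "G \<subseteq> Pow (space M)" "sets M = sigma_sets (space M) G"
    using assms by (auto simp: countably_generated_def)
  let ?S = "S \<inter> space M"
  have "sets (restrict_space M S) = (\<inter>) ?S ` sigma_sets (space M) G"
    unfolding sets_restrict_space G(3)[symmetric]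
    using sets.sets_into_space[of _ M] by (intro image_cong) auto
  also have "\<dots> = sigma_sets ?S ((\<inter>) ?S ` G)"
  proof (intro equalityI subsetI)
    have *: "{(\<lambda>x. x) -` A \<inter> ?S |A. A \<in> X} = (\<inter>) ?S ` X" for X :: "'a set set"
      by auto
    have "(\<inter>) ?S ` sigma_sets (space M) G = sigma_sets ?S ((\<inter>) ?S ` G)"
      using sigma_sets_vimage_commute[of "\<lambda>x. x" ?S "space M" G] unfolding * by auto
    then show "x \<in> (\<inter>) ?S ` sigma_sets (space M) G \<Longrightarrow> x \<in> sigma_sets ?S ((\<inter>) ?S ` G)"
      "x \<in> sigma_sets ?S ((\<inter>) ?S ` G) \<Longrightarrow> x \<in> (\<inter>) ?S ` sigma_sets (space M) G" for x
      by auto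
  qed
  finally show ?thesis
    using G(1) unfolding countably_generated_def
    by (intro exI[of _ "(\<inter>) ?S ` G"]) (auto simp: space_restrict_space)
qed

lemma countably_generated_pair:
  assumes "countably_generated M" "countably_generated N"
  shows "countably_generated (M \<Otimes>\<^sub>M N)"
proof -
  obtain G where G: "countable G" "G \<subseteq> sets M" "space M \<in> G" "sets M = sigma_sets (space M) G"
    using countably_generated_Int_stable[OF assms(1)] by metis
  obtain H where H: "countable H" "H \<subseteq> sets N" "space N \<in> H" "sets N = sigma_sets (space N) H"
    using countably_generated_Int_stable[OF assms(2)] by metis
  let ?E = "{a \<times> b | a b. a \<in> G \<and> b \<in> H}"
  have GH: "G \<subseteq> Pow (space M)" "H \<subseteq> Pow (space N)"
    using G(2) H(2) sets.sets_into_space by blast+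
  have "sets (M \<Otimes>\<^sub>M N) = sets (sigma (space M \<times> space N) ?E)"
    using GH G H by (intro sets_pair_eq[where Ca="{space M}" and Cb="{space N}"]) auto
  also have "\<dots> = sigma_sets (space M \<times> space N) ?E"
    using GH by (intro sets_measure_of) auto
  finally have "sets (M \<Otimes>\<^sub>M N) = sigma_sets (space (M \<Otimes>\<^sub>M N)) ?E"
    by (simp add: space_pair_measure)
  moreover have "countable ?E"
  proof -
    have "?E = (\<lambda>(a, b). a \<times> b) ` (G \<times> H)" by auto
    then show ?thesis using G(1) H(1) by auto
  qed
  moreover have "?E \<subseteq> Pow (space (M \<Otimes>\<^sub>M N))"
    using GH by (auto simp: space_pair_measure)
  ultimately show ?thesis unfolding countably_generated_def by blast
qed

lemma integrable_bounded_mult: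
  fixes g h :: "'a \<Rightarrow> complex"
  assumes [measurable]: "h \<in> borel_measurable M" and "AE x in M. norm (h x) \<le> C"
    and g: "integrable M g"
  shows "integrable M (\<lambda>x. h x * g x)"
    and "norm (\<integral>x. h x * g x \<partial>M) \<le> C * (\<integral>x. norm (g x) \<partial>M)"
proof -
  have AE: "AE x in M. norm (h x * g x) \<le> C * norm (g x)"
    using assms(2) by eventually_elim (auto simp: norm_mult mult_right_mono)
  have [measurable]: "g \<in> borel_measurable M" using g by auto
  show int: "integrable M (\<lambda>x. h x * g x)"
    by (rule Bochner_Integration.integrable_bound[where f="\<lambda>x. C * norm (g x)"])
      (use AE g in auto)
  have "norm (\<integral>x. h x * g x \<partial>M) \<le> (\<integral>x. norm (h x * g x) \<partial>M)"
    by (rule integral_norm_bound)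
  also have "\<dots> \<le> (\<integral>x. C * norm (g x) \<partial>M)"
    using int g AE by (intro integral_mono_AE) auto
  finally show "norm (\<integral>x. h x * g x \<partial>M) \<le> C * (\<integral>x. norm (g x) \<partial>M)" by simp
qed

text \<open>
  Since \<open>h\<close> is uniformly bounded, the pairings with \<open>s\<close> and with \<open>g\<close> differ by at most
  \<open>C \<parallel>s - g\<parallel>\<^sub>1\<close>, uniformly in the index \<open>n\<close>; a Cauchy argument with three terms then applies.
\<close>
lemma convergent_pairing_L1_closed:
  fixes g :: "'a \<Rightarrow> complex"
  assumes h: "\<And>n. h n \<in> borel_measurable M" "\<And>n. AE x in M. norm (h n x) \<le> C"
    and g: "integrable M g" and s: "\<And>k. integrable M (s k)"
    and conv: "\<And>k. convergent (\<lambda>n. \<integral>x. h n x * s k x \<partial>M)"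
    and lim: "(\<lambda>k. \<integral>x. norm (s k x - g x) \<partial>M) \<longlonglongrightarrow> 0"
  shows "convergent (\<lambda>n. \<integral>x. h n x * g x \<partial>M)"
proof -
  have "Cauchy (\<lambda>n. \<integral>x. h n x * g x \<partial>M)"
  proof (rule metric_CauchyI)
    fix e :: real assume "e > 0"
    have "(\<lambda>k. C * (\<integral>x. norm (s k x - g x) \<partial>M)) \<longlonglongrightarrow> 0"
      using tendsto_mult_right_zero[OF lim] by simp
    from order_tendstoD(2)[OF this, of "e/3"] \<open>e > 0\<close>
    obtain k where k: "C * (\<integral>x. norm (s k x - g x) \<partial>M) < e / 3"
      by (auto simp: eventually_sequentially)
    have near: "norm ((\<integral>x. h n x * s k x \<partial>M) - (\<integral>x. h n x * g x \<partial>M)) < e / 3" for n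
    proof -
      have "(\<integral>x. h n x * s k x \<partial>M) - (\<integral>x. h n x * g x \<partial>M) = (\<integral>x. h n x * (s k x - g x) \<partial>M)"
        using integrable_bounded_mult(1)[OF h s, of n k] integrable_bounded_mult(1)[OF h g, of n]
        by (simp add: right_diff_distrib)
      also have "norm \<dots> \<le> C * (\<integral>x. norm (s k x - g x) \<partial>M)"
        using s g by (intro integrable_bounded_mult(2)[OF h]) auto
      finally show ?thesis using k by linarith
    qed
    obtain n0 where n0: "\<And>m n. m \<ge> n0 \<Longrightarrow> n \<ge> n0 \<Longrightarrow>
        dist (\<integral>x. h m x * s k x \<partial>M) (\<integral>x. h n x * s k x \<partial>M) < e / 3"
      using metric_CauchyD[OF convergent_Cauchy[OF conv[of k]], of "e/3"] \<open>e > 0\<close> by auto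
    show "\<exists>n0. \<forall>m\<ge>n0. \<forall>n\<ge>n0. dist (\<integral>x. h m x * g x \<partial>M) (\<integral>x. h n x * g x \<partial>M) < e"
    proof (intro exI[of _ n0] allI impI)
      fix m n assume "m \<ge> n0" "n \<ge> n0"
      then show "dist (\<integral>x. h m x * g x \<partial>M) (\<integral>x. h n x * g x \<partial>M) < e"
        using n0[of m n] near[of m] near[of n]
          dist_triangle_third[of "\<integral>x. h m x * g x \<partial>M" "\<integral>x. h m x * s k x \<partial>M" e
            "\<integral>x. h n x * s k x \<partial>M" "\<integral>x. h n x * g x \<partial>M"]
        by (simp add: dist_norm norm_minus_commute)
    qed
  qed
  then show ?thesis by (rule Cauchy_convergent)
qed

text \<open>
  A diagonal argument gives convergence on the countable generator.  The class of sets on whose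
  indicator the pairings converge is a Dynkin system, because a countable disjoint union is an
  \<open>L\<^sup>1\<close>-limit of finite ones; and integrable functions are \<open>L\<^sup>1\<close>-limits of step functions.
\<close>
lemma (in finite_measure) weakly_convergent_subsequence_finite:
  fixes h :: "nat \<Rightarrow> 'a \<Rightarrow> complex"
  assumes cg: "countably_generated M"
    and h: "\<And>n. h n \<in> borel_measurable M" "\<And>n. AE x in M. norm (h n x) \<le> C"
  obtains r where "strict_mono r"
    "\<And>g. integrable M g \<Longrightarrow> convergent (\<lambda>n. \<integral>x. h (r n) x * g x \<partial>M)"
proof -
  obtain G where G: "countable G" "Int_stable G" "G \<subseteq> sets M" "space M \<in> G"
    "sets M = sigma_sets (space M) G"
    using countably_generated_Int_stable[OF cg] .
  have int1: "integrable M (indicator A :: 'a \<Rightarrow> complex)" if "A \<in> sets M" for A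
    using that by (intro integrable_const_bound[where B=1]) (auto simp: indicator_def)
  have "norm (\<integral>x. h n x * indicator A x \<partial>M) \<le> \<bar>C\<bar> * measure M (space M)" if "A \<in> G" for n A
  proof -
    have A: "A \<in> sets M" using that G by auto
    have "norm (\<integral>x. h n x * indicator A x \<partial>M) \<le> C * (\<integral>x. norm (indicator A x :: complex) \<partial>M)"
      by (rule integrable_bounded_mult[OF h int1[OF A]])
    also have "\<dots> = C * measure M A"
      proof -
      have "norm (indicator A x :: complex) = indicator A x" for x by (simp add: indicator_def)
      then show ?thesis using A by simp
    qed
    also have "\<dots> \<le> \<bar>C\<bar> * measure M (space M)"
      using A by (intro mult_mono bounded_measure) auto
    finally show ?thesis .
  qed
  from function_convergent_subsequence[OF G(1), of "\<lambda>n A. \<integral>x. h n x * indicator A x \<partial>M", OF this]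
  obtain r where r: "strict_mono (r :: nat \<Rightarrow> nat)"
    "\<And>A. A \<in> G \<Longrightarrow> \<exists>l. (\<lambda>n. \<integral>x. h (r n) x * indicator A x \<partial>M) \<longlonglongrightarrow> l"
    by metis
  note hr = h(1)[of "r _"] h(2)[of "r _"]
  note closed = convergent_pairing_L1_closed[of "\<lambda>n. h (r n)", OF hr]
  have ind: "convergent (\<lambda>n. \<integral>x. h (r n) x * indicator A x \<partial>M)" if "A \<in> sets M" for A
  proof -
    have Gs: "G \<subseteq> Pow (space M)" using G(3) sets.sets_into_space by blast
    from that have "A \<in> sigma_sets (space M) G" using G(5) by simp
    with G(2) Gs show ?thesis
    proof (induction rule: sigma_sets_induct_disjoint)
      case (basic A)
      then show ?case using r(2) by (simp add: convergent_def)
    next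
      case empty
      show ?case by (simp add: convergent_const)
    next
      case (compl A)
      have A: "A \<in> sets M" using compl G(5) by simp
      have "(\<integral>x. h (r n) x * indicator (space M - A) x \<partial>M) =
        (\<integral>x. h (r n) x * indicator (space M) x \<partial>M) - (\<integral>x. h (r n) x * indicator A x \<partial>M)" for n
      proof (subst Bochner_Integration.integral_diff[symmetric])
        show "integrable M (\<lambda>x. h (r n) x * indicator (space M) x)"
          "integrable M (\<lambda>x. h (r n) x * indicator A x)"
          using A by (auto intro!: integrable_bounded_mult(1)[OF hr] int1)
        show "(\<integral>x. h (r n) x * indicator (space M - A) x \<partial>M) =
          (\<integral>x. h (r n) x * indicator (space M) x - h (r n) x * indicator A x \<partial>M)"
          by (intro Bochner_Integration.integral_cong) (auto simp: indicator_def)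
      qed
      moreover have "convergent (\<lambda>n. \<integral>x. h (r n) x * indicator (space M) x \<partial>M)"
        using r(2)[OF G(4)] by (simp add: convergent_def)
      ultimately show ?case using compl by (simp add: convergent_diff)
    next
      case (union A)
      have A: "A i \<in> sets M" for i using union G(5) by auto
      define s where "s k x = (\<Sum>i<k. indicator (A i) x :: complex)" for k x
      have s_eq: "s k = indicator (\<Union>i<k. A i)" for k
      proof
        fix x show "s k x = indicator (\<Union>i<k. A i) x"
          unfolding s_def
          using union(1)
          by (subst indicator_UN_disjoint) (auto simp: disjoint_family_on_def)
      qed
      show ?case
      proof (rule closed[of _ s])
        show "integrable M (indicator (\<Union> (range A)) :: 'a \<Rightarrow> complex)"
          using A by (intro int1) auto
        show "integrable M (s k)" for k unfolding s_eq using A by (intro int1) auto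
        show "convergent (\<lambda>n. \<integral>x. h (r n) x * s k x \<partial>M)" for k
        proof -
          have "(\<integral>x. h (r n) x * s k x \<partial>M) = (\<Sum>i<k. \<integral>x. h (r n) x * indicator (A i) x \<partial>M)" for n
            unfolding s_def sum_distrib_left
            by (rule Bochner_Integration.integral_sum) (auto intro!: integrable_bounded_mult(1)[OF hr] int1 A)
          then show ?thesis using union(3) by (simp add: convergent_sum)
        qed
        have "(\<integral>x. norm (s k x - indicator (\<Union> (range A)) x) \<partial>M)
            = measure M (\<Union> (range A)) - measure M (\<Union>i<k. A i)" for k
        proof -
          have "(\<integral>x. norm (s k x - indicator (\<Union> (range A)) x) \<partial>M)
              = (\<integral>x. indicator (\<Union> (range A) - (\<Union>i<k. A i)) x \<partial>M)"
            unfolding s_eq by (intro Bochner_Integration.integral_cong) (auto simp: indicator_def)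
          also have "\<dots> = measure M (\<Union> (range A) - (\<Union>i<k. A i))"
            using A by (simp add: sets.Diff sets.countable_UN)
          also have "\<dots> = measure M (\<Union> (range A)) - measure M (\<Union>i<k. A i)"
            using A by (intro finite_measure_Diff) auto
          finally show ?thesis by simp
        qed
        moreover have "(\<lambda>k. measure M (\<Union>i<k. A i)) \<longlonglongrightarrow> measure M (\<Union>k. \<Union>i<k. A i)"
          using A by (intro finite_Lim_measure_incseq) (auto simp: incseq_def, fastforce)
        moreover have "(\<Union>k. \<Union>i<k. A i) = \<Union> (range A)" by auto
        ultimately show "(\<lambda>k. \<integral>x. norm (s k x - indicator (\<Union> (range A)) x) \<partial>M) \<longlonglongrightarrow> 0"
          by (auto intro!: tendsto_eq_intros)
      qed
    qed
  qed
  have "convergent (\<lambda>n. \<integral>x. h (r n) x * g x \<partial>M)" if "integrable M g" for g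
    using that
  proof (induction g rule: integrable_induct)
    case (base A c)
    have "(\<integral>x. h (r n) x * (indicator A x *\<^sub>R c) \<partial>M) = c * (\<integral>x. h (r n) x * indicator A x \<partial>M)" for n
    proof -
      have "(\<lambda>x. h (r n) x * (indicator A x *\<^sub>R c)) = (\<lambda>x. c * (h (r n) x * indicator A x))"
        by (auto simp: indicator_def)
      then show ?thesis by simp
    qed
    then show ?case using ind[OF base(1)] by (simp add: convergent_mult convergent_const)
  next
    case (add f g)
    have "(\<integral>x. h (r n) x * (f x + g x) \<partial>M) = (\<integral>x. h (r n) x * f x \<partial>M) + (\<integral>x. h (r n) x * g x \<partial>M)" for n
      using integrable_bounded_mult(1)[OF hr add.hyps(1)] integrable_bounded_mult(1)[OF hr add.hyps(2)]
      by (simp add: distrib_left)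
    then show ?case using add.IH by (simp add: convergent_add)
  next
    case (lim f s)
    show ?case
    proof (rule closed[OF lim.hyps(4) lim.hyps(1) lim.IH])
      have [measurable]: "f \<in> borel_measurable M" "s k \<in> borel_measurable M" for k
        using lim.hyps(1,4) by auto
      have "(\<lambda>k. \<integral>x. norm (s k x - f x) \<partial>M) \<longlonglongrightarrow> (\<integral>x. 0 \<partial>M)"
      proof (rule integral_dominated_convergence[where w="\<lambda>x. 3 * norm (f x)"])
        show "integrable M (\<lambda>x. 3 * norm (f x))" using lim.hyps(4) by auto
        show "AE x in M. (\<lambda>k. norm (s k x - f x)) \<longlonglongrightarrow> 0"
          using lim.hyps(2) by (auto intro!: tendsto_norm_zero LIM_zero)
        show "AE x in M. norm (norm (s k x - f x)) \<le> 3 * norm (f x)" for k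
        proof (rule AE_I2)
          fix x assume "x \<in> space M"
          have "norm (s k x - f x) \<le> norm (s k x) + norm (f x)" by (rule norm_triangle_ineq4)
          with lim.hyps(3)[OF \<open>x \<in> space M\<close>, of k]
          show "norm (norm (s k x - f x)) \<le> 3 * norm (f x)" by simp
        qed
      qed auto
      then show "(\<lambda>k. \<integral>x. norm (s k x - f x) \<partial>M) \<longlonglongrightarrow> 0" by simp
    qed
  qed
  with r(1) show ?thesis by (rule that)
qed

text \<open>
  Multiplying the measure by a strictly positive integrable function \<open>v\<close> makes it finite and turns
  the test function \<open>g\<close> into \<open>g / v\<close>; the pairings are unchanged.
\<close>
lemma (in sigma_finite_measure) weakly_convergent_subsequence:
  fixes h :: "nat \<Rightarrow> 'a \<Rightarrow> complex"
  assumes cg: "countably_generated M"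
    and h: "\<And>n. h n \<in> borel_measurable M" "\<And>n. AE x in M. norm (h n x) \<le> C"
  obtains r where "strict_mono r"
    "\<And>g. integrable M g \<Longrightarrow> convergent (\<lambda>n. \<integral>x. h (r n) x * g x \<partial>M)"
proof -
  obtain v :: "'a \<Rightarrow> real" where v: "v \<in> borel_measurable M" "\<And>x. v x > 0" "integrable M v"
    using obtain_positive_integrable_function by metis
  note [measurable] = v(1) h(1)
  let ?N = "density M (\<lambda>x. ennreal (v x))"
  interpret N: finite_measure ?N
  proof
    have "emeasure ?N (space ?N) = (\<integral>\<^sup>+x. ennreal (v x) \<partial>M)"
      by (auto simp: emeasure_density intro!: nn_integral_cong)
    also have "\<dots> < \<infinity>" using v(3) v(2) by (auto simp: integrable_iff_bounded less_imp_le)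
    finally show "emeasure ?N (space ?N) \<noteq> \<infinity>" by simp
  qed
  have cgN: "countably_generated ?N"
    using cg countably_generated_sets_cong[of M ?N] by simp
  have hN: "h n \<in> borel_measurable ?N" "AE x in ?N. norm (h n x) \<le> C" for n
    subgoal using h(1) by simp
    subgoal using h(2)[of n] by (subst AE_density) (auto elim!: eventually_mono)
    done
  obtain r where r: "strict_mono r"
    "\<And>g. integrable ?N g \<Longrightarrow> convergent (\<lambda>n. \<integral>x. h (r n) x * g x \<partial>?N)"
    by (rule N.weakly_convergent_subsequence_finite[of h C, OF cgN hN]) blast
  have "convergent (\<lambda>n. \<integral>x. h (r n) x * g x \<partial>M)" if g: "integrable M g" for g
  proof -
    have [measurable]: "g \<in> borel_measurable M" using g by auto
    let ?g = "\<lambda>x. inverse (v x) *\<^sub>R g x"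
    have vi: "v x *\<^sub>R (inverse (v x) *\<^sub>R z) = z" for x and z :: complex
      using v(2)[of x] by simp
    have "integrable ?N ?g"
      using g v(2) by (subst integrable_density) (simp_all add: vi less_imp_le del: scaleR_scaleR)
    from r(2)[OF this] have "convergent (\<lambda>n. \<integral>x. h (r n) x * ?g x \<partial>?N)" .
    moreover have "(\<integral>x. h (r n) x * ?g x \<partial>?N) = (\<integral>x. h (r n) x * g x \<partial>M)" for n
    proof -
      have "v x *\<^sub>R (h (r n) x * ?g x) = h (r n) x * g x" for x
        using vi[of x "g x"] by (simp only: mult_scaleR_right[symmetric])
      moreover have "(\<integral>x. h (r n) x * ?g x \<partial>?N) = (\<integral>x. v x *\<^sub>R (h (r n) x * ?g x) \<partial>M)"
        using v(2) by (subst integral_density) (auto simp: less_imp_le)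
      ultimately show ?thesis by simp
    qed
    ultimately show ?thesis by simp
  qed
  with r(1) show ?thesis by (rule that)
qed

section \<open>Elementary \<open>L\<^sup>p\<close> estimates\<close>

lemma Lp_space_measurable: "f \<in> Lp_space M p \<Longrightarrow> f \<in> borel_measurable M"
  by (simp add: Lp_space_def)

lemma Lp_norm_nonneg: "0 \<le> Lp_norm M p f"
  by (simp add: Lp_norm_def)

lemma enn2real_ge_1: "1 \<le> p \<Longrightarrow> p \<noteq> \<infinity> \<Longrightarrow> 1 \<le> enn2real p"
  by (metis enn2real_mono enn2real_1 infinity_ennreal_def less_top)

lemma Lp_space_infinity_AE:
  assumes "f \<in> Lp_space M \<infinity>"
  shows "AE x in M. norm (f x) \<le> Lp_norm M \<infinity> f"
proof -
  let ?e = "esssup M (\<lambda>x. ennreal (norm (f x)))"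
  have "?e < \<infinity>" using assms by (simp add: Lp_space_def)
  then have "?e = ennreal (Lp_norm M \<infinity> f)"
    by (simp add: Lp_norm_def less_top)
  then show ?thesis
    using esssup_AE[of "\<lambda>x. ennreal (norm (f x))" M] Lp_norm_nonneg[of M \<infinity> f] by simp
qed

lemma Lp_norm_infinity_le:
  assumes "f \<in> borel_measurable M" "AE x in M. norm (f x) \<le> c" "0 \<le> c"
  shows "Lp_norm M \<infinity> f \<le> c"
proof -
  have "esssup M (\<lambda>x. ennreal (norm (f x))) \<le> ennreal c"
    using assms by (intro esssup_I) (auto elim!: eventually_mono)
  then show ?thesis
    using assms(3) enn2real_mono[of _ "ennreal c"] by (simp add: Lp_norm_def)
qed

lemma Lp_space_finite_integrable:
  assumes "f \<in> Lp_space M p" "p \<noteq> \<infinity>"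
  shows "integrable M (\<lambda>x. norm (f x) powr enn2real p)"
  using assms by (simp add: Lp_space_def)

lemma integral_powr_le_Lp_norm:
  assumes "1 \<le> p" "p \<noteq> \<infinity>" "Lp_norm M p f \<le> c"
  shows "(\<integral>x. norm (f x) powr enn2real p \<partial>M) \<le> c powr enn2real p"
proof -
  let ?q = "enn2real p" and ?I = "\<integral>x. norm (f x) powr enn2real p \<partial>M"
  have q: "1 \<le> ?q" using assms by (intro enn2real_ge_1)
  have "?I = (?I powr (1 / ?q)) powr ?q"
    using q by (simp add: powr_powr)
  also have "\<dots> \<le> c powr ?q"
    using assms q by (intro powr_mono2) (auto simp: Lp_norm_def)
  finally show ?thesis .
qed

lemma Lp_space_dominated:
  assumes g: "g \<in> Lp_space M p" and f[measurable]: "f \<in> borel_measurable M"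
    and le: "AE x in M. norm (f x) \<le> c * norm (g x)" and "0 \<le> c"
  shows "f \<in> Lp_space M p"
proof (cases "p = \<infinity>")
  case True
  have "AE x in M. norm (f x) \<le> c * Lp_norm M \<infinity> g"
    using le Lp_space_infinity_AE[of g M] g True
    by (auto elim!: eventually_elim2 intro: order_trans mult_left_mono[OF _ \<open>0 \<le> c\<close>])
  then have "esssup M (\<lambda>x. ennreal (norm (f x))) \<le> ennreal (c * Lp_norm M \<infinity> g)"
    by (intro esssup_I) (auto elim!: eventually_mono intro: ennreal_leI)
  also have "\<dots> < \<infinity>" by simp
  finally show ?thesis using True f by (simp add: Lp_space_def)
next
  case False
  let ?q = "enn2real p"
  have [measurable]: "g \<in> borel_measurable M" using g by (rule Lp_space_measurable)
  have "integrable M (\<lambda>x. c powr ?q * norm (g x) powr ?q)"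
    using Lp_space_finite_integrable[OF g False] by simp
  then have "integrable M (\<lambda>x. norm (f x) powr ?q)"
  proof (rule Bochner_Integration.integrable_bound)
    show "AE x in M. norm (norm (f x) powr ?q) \<le> norm (c powr ?q * norm (g x) powr ?q)"
      using le
    proof eventually_elim
      case (elim x)
      have "norm (f x) powr ?q \<le> (c * norm (g x)) powr ?q"
        using elim by (intro powr_mono2) auto
      then show ?case using \<open>0 \<le> c\<close> by (simp add: powr_mult)
    qed
  qed measurable
  then show ?thesis using False f by (simp add: Lp_space_def)
qed

text \<open>
  A crude form of Young's inequality that replaces Hoelder's and Jensen's inequalities below: with
  the parameter \<open>l\<close> chosen to balance the two terms it has the right homogeneity, and constants do
  not matter for compactness.
\<close>
lemma le_add_powr_scaled:
  fixes l q t :: real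
  assumes "0 < l" "1 \<le> q" "0 \<le> t"
  shows "t \<le> l + l powr (1 - q) * t powr q"
proof (cases "t \<le> l")
  case True
  then show ?thesis by (simp add: add_increasing2)
next
  case False
  then have "0 < t" "1 \<le> t / l" using assms by auto
  have "t powr q = t powr (q - 1) * t" using \<open>0 < t\<close> powr_add[of t "q - 1" 1] by simp
  moreover have "l powr (1 - q) = inverse (l powr (q - 1))"
    using powr_minus[of l "q - 1"] by simp
  ultimately have "l powr (1 - q) * t powr q = (t / l) powr (q - 1) * t"
    using \<open>0 < t\<close> \<open>0 < l\<close> by (simp add: powr_divide field_simps)
  moreover have "1 \<le> (t / l) powr (q - 1)"
    using \<open>1 \<le> t / l\<close> assms by (intro ge_one_powr_ge_zero) auto
  ultimately have "t \<le> l powr (1 - q) * t powr q"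
    using \<open>0 < t\<close> by simp
  then show ?thesis using \<open>0 < l\<close> by linarith
qed

lemma nn_integral_mult_le_split:
  fixes f k :: "'a \<Rightarrow> real"
  assumes [measurable]: "f \<in> borel_measurable M" "k \<in> borel_measurable M"
    and nonneg: "\<And>x. 0 \<le> f x" "\<And>x. 0 \<le> k x" and "0 < l" "1 \<le> q"
  shows "(\<integral>\<^sup>+x. ennreal (f x * k x) \<partial>M) \<le>
    ennreal l * (\<integral>\<^sup>+x. ennreal (k x) \<partial>M)
    + ennreal (l powr (1 - q)) * (\<integral>\<^sup>+x. ennreal (f x powr q * k x) \<partial>M)"
proof -
  have "(\<integral>\<^sup>+x. ennreal (f x * k x) \<partial>M) \<le>
      (\<integral>\<^sup>+x. ennreal l * ennreal (k x) + ennreal (l powr (1 - q)) * ennreal (f x powr q * k x) \<partial>M)"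
  proof (rule nn_integral_mono)
    fix x
    have "f x * k x \<le> (l + l powr (1 - q) * f x powr q) * k x"
      using assms by (intro mult_right_mono le_add_powr_scaled) auto
    also have "\<dots> = l * k x + l powr (1 - q) * (f x powr q * k x)" by (simp add: algebra_simps)
    finally have "ennreal (f x * k x) \<le> ennreal (l * k x + l powr (1 - q) * (f x powr q * k x))"
      by (rule ennreal_leI)
    then show "ennreal (f x * k x) \<le>
        ennreal l * ennreal (k x) + ennreal (l powr (1 - q)) * ennreal (f x powr q * k x)"
      using assms by (simp add: ennreal_mult ennreal_plus)
  qed
  also have "\<dots> = ennreal l * (\<integral>\<^sup>+x. ennreal (k x) \<partial>M)
    + ennreal (l powr (1 - q)) * (\<integral>\<^sup>+x. ennreal (f x powr q * k x) \<partial>M)"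
    by (simp add: nn_integral_add nn_integral_cmult)
  finally show ?thesis .
qed

lemma borel_measurable_cnj [measurable (raw)]:
  "f \<in> borel_measurable M \<Longrightarrow> (\<lambda>x. cnj (f x)) \<in> borel_measurable M"
  by (rule measurable_compose[of _ _ borel])
    (auto intro!: borel_measurable_continuous_onI continuous_intros)


section \<open>Families of windows bounded in \<open>L\<^sup>1\<close> and \<open>L\<^sup>\<infinity>\<close>\<close>

text \<open>
  The weight \<open>A\<close> balances the two norms of the window \<open>K w\<close>, as the dilation factor does for
  wavelets.  By interpolation \<open>K w\<close> has \<open>L\<^sup>q\<close> norm at most \<open>B A\<^bsup>2/q-1\<^esup>\<close>.
\<close>
locale window_family = M: sigma_finite_measure M + N: sigma_finite_measure N
  for M :: "'a measure" and N :: "'b measure" +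
  fixes K :: "'b \<Rightarrow> 'a \<Rightarrow> complex" and A :: "'b \<Rightarrow> real" and B :: real
  assumes K_measurable: "(\<lambda>(w, z). K w z) \<in> borel_measurable (N \<Otimes>\<^sub>M M)"
    and A_measurable[measurable]: "A \<in> borel_measurable N"
    and A_pos: "\<And>w. w \<in> space N \<Longrightarrow> 0 < A w"
    and B_pos: "0 < B"
    and K_L1: "\<And>w. w \<in> space N \<Longrightarrow> (\<integral>\<^sup>+z. ennreal (norm (K w z)) \<partial>M) \<le> ennreal (B * A w)"
    and K_bounded: "\<And>w. w \<in> space N \<Longrightarrow> AE z in M. norm (K w z) \<le> B / A w"
begin

lemma K_measurable_swap: "(\<lambda>(z, w). K w z) \<in> borel_measurable (M \<Otimes>\<^sub>M N)"
  using measurable_compose[OF measurable_pair_swap' K_measurable] by (simp add: case_prod_beta')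

lemma K_measurable_snd: "w \<in> space N \<Longrightarrow> K w \<in> borel_measurable M"
  using measurable_compose[OF measurable_Pair1' K_measurable] by simp

lemma K_measurable_fst: "z \<in> space M \<Longrightarrow> (\<lambda>w. K w z) \<in> borel_measurable N"
  using measurable_compose[OF measurable_Pair2' K_measurable] by simp

lemma K_integrable: "w \<in> space N \<Longrightarrow> integrable M (K w)"
  using K_L1[of w] K_measurable_snd[of w]
  by (auto simp: integrable_iff_bounded intro: le_less_trans)

text \<open>
  The exceptional null set in the bound on \<open>K w\<close> may depend on \<open>w\<close>; by Fubini's theorem almost every
  point \<open>z\<close> is exceptional only for a null set of parameters.
\<close>
lemma K_bounded_swap: "AE z in M. AE w in N. norm (K w z) \<le> B / A w"
proof -
  interpret P: pair_sigma_finite N M by unfold_locales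
  have "AE w in N. AE z in M. norm (K w z) \<le> B / A w"
    using K_bounded by auto
  moreover have "{x \<in> space (N \<Otimes>\<^sub>M M). norm (K (fst x) (snd x)) \<le> B / A (fst x)} \<in> sets (N \<Otimes>\<^sub>M M)"
  proof -
    have [measurable]: "(\<lambda>x. K (fst x) (snd x)) \<in> borel_measurable (N \<Otimes>\<^sub>M M)"
      using K_measurable by (simp add: case_prod_beta')
    show ?thesis by measurable
  qed
  ultimately show ?thesis
    by (subst (asm) P.AE_commute)
qed

text \<open>
  Pairing with \<open>K w\<close> costs \<open>A\<^bsup>1-2/p\<^esup>\<close>.  As \<open>enn2real \<infinity> = 0\<close> and division by zero gives zero, the
  exponent \<open>1 - 2 / enn2real p\<close> has its correct value \<open>1\<close> at \<open>p = \<infinity>\<close>, so that one formula serves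
  all exponents.
\<close>
lemma analysis_bound:
  assumes f: "f \<in> Lp_space M p" and p: "1 \<le> p" and c: "Lp_norm M p f \<le> c" and w: "w \<in> space N"
  shows "(\<integral>\<^sup>+z. ennreal (norm (f z * cnj (K w z))) \<partial>M)
    \<le> ennreal (B * (1 + c + c powr enn2real p) * A w powr (1 - 2 / enn2real p))"
proof -
  have [measurable]: "f \<in> borel_measurable M" "K w \<in> borel_measurable M"
    using Lp_space_measurable[OF f] K_measurable_snd[OF w] by auto
  have c0: "0 \<le> c" using Lp_norm_nonneg[of M p f] c by linarith
  have Aw: "0 < A w" using A_pos[OF w] .
  have norm_eq: "norm (f z * cnj (K w z)) = norm (f z) * norm (K w z)" for z
    by (simp add: norm_mult)
  show ?thesis
  proof (cases "p = \<infinity>")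
    case True
    have "AE z in M. norm (f z) \<le> c"
      using Lp_space_infinity_AE[of f M] f c True by (auto elim!: eventually_mono)
    then have "AE z in M. ennreal (norm (f z * cnj (K w z))) \<le> ennreal c * ennreal (norm (K w z))"
      by eventually_elim
        (auto simp: norm_eq ennreal_mult[symmetric] c0 intro!: ennreal_leI mult_right_mono)
    then have "(\<integral>\<^sup>+z. ennreal (norm (f z * cnj (K w z))) \<partial>M)
        \<le> (\<integral>\<^sup>+z. ennreal c * ennreal (norm (K w z)) \<partial>M)"
      by (rule nn_integral_mono_AE)
    also have "\<dots> \<le> ennreal c * ennreal (B * A w)"
      by (subst nn_integral_cmult) (auto intro!: mult_left_mono K_L1 w)
    also have "\<dots> = ennreal (B * c * A w)"
      using c0 B_pos Aw by (simp add: ennreal_mult[symmetric] mult_ac)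
    also have "\<dots> \<le> ennreal (B * (1 + c + c powr enn2real p) * A w)"
      using c0 B_pos Aw by (intro ennreal_leI mult_right_mono mult_left_mono) auto
    finally show ?thesis using True Aw by simp
  next
    case False
    define q where "q = enn2real p"
    have q: "1 \<le> q" unfolding q_def using p False by (rule enn2real_ge_1)
    define I where "I = (\<integral>z. norm (f z) powr q \<partial>M)"
    have I: "0 \<le> I" "I \<le> c powr q"
      using integral_powr_le_Lp_norm[OF p False c] by (auto simp: I_def q_def)
    \<comment> \<open>This value of \<open>l\<close> makes both terms of the split proportional to \<open>A\<^bsup>1-2/q\<^esup>\<close>.\<close>
    define l where "l = A w powr (- 2 / q)"
    have l: "0 < l" using Aw by (simp add: l_def)
    have lA: "l * A w = A w powr (1 - 2 / q)"
      unfolding l_def using Aw powr_add[of "A w" "- 2 / q" 1] by (simp add: algebra_simps)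
    have lA': "l powr (1 - q) / A w = A w powr (1 - 2 / q)"
    proof -
      have "l powr (1 - q) / A w = A w powr ((- 2 / q) * (1 - q) + (- 1))"
        unfolding l_def powr_powr powr_add using Aw by (simp add: powr_minus_divide)
      also have "(- 2 / q) * (1 - q) + (- 1) = 1 - 2 / q" using q by (simp add: field_simps)
      finally show ?thesis .
    qed
    have "(\<integral>\<^sup>+z. ennreal (norm (f z) powr q * norm (K w z)) \<partial>M)
        \<le> (\<integral>\<^sup>+z. ennreal (B / A w) * ennreal (norm (f z) powr q) \<partial>M)"
    proof (intro nn_integral_mono_AE, use K_bounded[OF w] in eventually_elim)
      case (elim z)
      then have "norm (f z) powr q * norm (K w z) \<le> B / A w * norm (f z) powr q"
        by (subst mult.commute) (intro mult_right_mono, auto)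
      then show ?case
        using B_pos Aw by (simp add: ennreal_mult[symmetric] ennreal_leI del: times_divide_eq_left)
    qed
    also have "\<dots> = ennreal (B / A w) * ennreal I"
    proof (subst nn_integral_cmult)
      have "(\<integral>\<^sup>+z. ennreal (norm (f z) powr q) \<partial>M) = ennreal I"
        unfolding I_def q_def
        by (rule nn_integral_eq_integral[OF Lp_space_finite_integrable[OF f False]]) auto
      then show "ennreal (B / A w) * (\<integral>\<^sup>+z. ennreal (norm (f z) powr q) \<partial>M) = ennreal (B / A w) * ennreal I"
        by simp
    qed measurable
    finally have J: "(\<integral>\<^sup>+z. ennreal (norm (f z) powr q * norm (K w z)) \<partial>M) \<le> ennreal (B / A w) * ennreal I" .
    have "(\<integral>\<^sup>+z. ennreal (norm (f z * cnj (K w z))) \<partial>M) \<le>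
        ennreal l * (\<integral>\<^sup>+z. ennreal (norm (K w z)) \<partial>M)
        + ennreal (l powr (1 - q)) * (\<integral>\<^sup>+z. ennreal (norm (f z) powr q * norm (K w z)) \<partial>M)"
      unfolding norm_eq by (rule nn_integral_mult_le_split) (use l q in auto)
    also have "\<dots> \<le> ennreal l * ennreal (B * A w)
        + ennreal (l powr (1 - q)) * (ennreal (B / A w) * ennreal I)"
      by (intro add_mono mult_left_mono J K_L1 w) auto
    also have "\<dots> = ennreal (l * (B * A w) + l powr (1 - q) * (B / A w * I))"
      using l B_pos Aw I by (simp add: ennreal_mult[symmetric] ennreal_plus[symmetric] del: ennreal_plus)
    also have "l * (B * A w) + l powr (1 - q) * (B / A w * I)
        = B * (l * A w) + B * (l powr (1 - q) / A w) * I"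
      by (simp add: algebra_simps)
    also have "\<dots> = B * (1 + I) * A w powr (1 - 2 / q)"
      unfolding lA lA' by (simp add: algebra_simps)
    also have "ennreal \<dots> \<le> ennreal (B * (1 + c + c powr q) * A w powr (1 - 2 / q))"
      using I c0 B_pos by (intro ennreal_leI mult_right_mono mult_left_mono) auto
    finally show ?thesis unfolding q_def .
  qed
qed

lemma analysis_integrable:
  assumes "f \<in> Lp_space M p" "1 \<le> p" "w \<in> space N"
  shows "integrable M (\<lambda>z. f z * cnj (K w z))"
proof -
  have [measurable]: "f \<in> borel_measurable M" "K w \<in> borel_measurable M"
    using Lp_space_measurable[OF assms(1)] K_measurable_snd[OF assms(3)] by auto
  show ?thesis
    using analysis_bound[OF assms(1,2) order_refl assms(3)]
    by (auto simp: integrable_iff_bounded intro: le_less_trans)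
qed

lemma norm_analysis_le:
  assumes "f \<in> Lp_space M p" "1 \<le> p" "Lp_norm M p f \<le> c" "w \<in> space N"
  shows "norm (\<integral>z. f z * cnj (K w z) \<partial>M)
    \<le> B * (1 + c + c powr enn2real p) * A w powr (1 - 2 / enn2real p)"
proof -
  have "ennreal (norm (\<integral>z. f z * cnj (K w z) \<partial>M))
      \<le> (\<integral>\<^sup>+z. ennreal (norm (f z * cnj (K w z))) \<partial>M)"
    by (rule integral_norm_bound_ennreal[OF analysis_integrable[OF assms(1,2,4)]])
  also have "\<dots> \<le> ennreal (B * (1 + c + c powr enn2real p) * A w powr (1 - 2 / enn2real p))"
    by (rule analysis_bound[OF assms])
  finally show ?thesis
    using B_pos order_trans[OF Lp_norm_nonneg assms(3)] by (simp add: ennreal_le_iff)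
qed

lemma analysis_measurable:
  assumes [measurable]: "f \<in> borel_measurable M"
  shows "(\<lambda>w. \<integral>z. f z * cnj (K w z) \<partial>M) \<in> borel_measurable N"
proof -
  have [measurable]: "(\<lambda>x. K (fst x) (snd x)) \<in> borel_measurable (N \<Otimes>\<^sub>M M)"
    using K_measurable by (simp add: case_prod_beta')
  have "(\<lambda>(w, z). f z * cnj (K w z)) \<in> borel_measurable (N \<Otimes>\<^sub>M M)"
    unfolding case_prod_beta' by measurable
  then show ?thesis by (rule M.borel_measurable_lebesgue_integral)
qed

lemma synthesis_measurable:
  assumes [measurable]: "h \<in> borel_measurable N"
  shows "(\<lambda>y. \<integral>w. h w * K w y \<partial>N) \<in> borel_measurable M"
proof -
  have [measurable]: "(\<lambda>x. K (snd x) (fst x)) \<in> borel_measurable (M \<Otimes>\<^sub>M N)"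
    using K_measurable_swap by (simp add: case_prod_beta')
  have "(\<lambda>(y, w). h w * K w y) \<in> borel_measurable (M \<Otimes>\<^sub>M N)"
    unfolding case_prod_beta' by measurable
  then show ?thesis by (rule N.borel_measurable_lebesgue_integral)
qed

text \<open>
  A superposition with coefficients of size \<open>\<bar>\<sigma>\<bar> A\<^bsup>1-2/p\<^esup>\<close> has an \<open>L\<^sup>p\<close> majorant \<open>D\<close>: each
  function \<open>A\<^bsup>1-2/p\<^esup> \<bar>K w\<bar>\<close> has \<open>L\<^sup>p\<close> norm at most \<open>B\<close>, and averaging over the finite measure
  \<open>\<bar>\<sigma>\<bar>\<close> preserves this up to a constant.  For \<open>p < \<infinity>\<close> the majorant is a multiple of \<open>J\<^bsup>1/p\<^esup>\<close>, where
  \<open>J\<close> is the average of the \<open>p\<close>-th powers, which is integrable by Tonelli's theorem.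
\<close>
lemma synthesis_dominated:
  assumes \<sigma>: "integrable N \<sigma>" and p: "1 \<le> p"
  obtains D :: "'a \<Rightarrow> real" where "\<And>y. 0 \<le> D y" "(\<lambda>y. complex_of_real (D y)) \<in> Lp_space M p"
    "AE y in M. (\<integral>\<^sup>+w. ennreal (norm (\<sigma> w :: complex) * (A w powr (1 - 2 / enn2real p) * norm (K w y))) \<partial>N)
       \<le> ennreal (D y)"
proof -
  have [measurable]: "\<sigma> \<in> borel_measurable N" using \<sigma> by auto
  have [measurable]: "(\<lambda>x. K (snd x) (fst x)) \<in> borel_measurable (M \<Otimes>\<^sub>M N)"
    using K_measurable_swap by (simp add: case_prod_beta')
  define m where "m = (\<integral>w. norm (\<sigma> w) \<partial>N)"
  have m: "0 \<le> m" "(\<integral>\<^sup>+w. ennreal (norm (\<sigma> w)) \<partial>N) = ennreal m"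
    unfolding m_def using \<sigma> by (auto intro: nn_integral_eq_integral)
  show thesis
  proof (cases "p = \<infinity>")
    case True
    show thesis
    proof (rule that[of "\<lambda>y. B * m"])
      show "0 \<le> B * m" using B_pos m by simp
      have "esssup M (\<lambda>x. ennreal (norm (complex_of_real (B * m)))) \<le> ennreal (norm (complex_of_real (B * m)))"
        by (intro esssup_I) auto
      also have "\<dots> < \<infinity>" by simp
      finally show "(\<lambda>y. complex_of_real (B * m)) \<in> Lp_space M p"
        using True by (simp add: Lp_space_def)
      show "AE y in M. (\<integral>\<^sup>+w. ennreal (norm (\<sigma> w) * (A w powr (1 - 2 / enn2real p) * norm (K w y))) \<partial>N)
          \<le> ennreal (B * m)"
        using K_bounded_swap
      proof eventually_elim
        case (elim y)
        then have "AE w in N. ennreal (norm (\<sigma> w) * (A w powr (1 - 2 / enn2real p) * norm (K w y)))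
            \<le> ennreal B * ennreal (norm (\<sigma> w))"
        proof (rule AE_mp, intro AE_I2 impI)
          fix w assume w: "w \<in> space N" and le: "norm (K w y) \<le> B / A w"
          have "A w * norm (K w y) \<le> B"
            using le A_pos[OF w] by (simp add: field_simps)
          then have "norm (\<sigma> w) * (A w * norm (K w y)) \<le> B * norm (\<sigma> w)"
            by (subst mult.commute) (rule mult_right_mono, auto)
          then show "ennreal (norm (\<sigma> w) * (A w powr (1 - 2 / enn2real p) * norm (K w y)))
            \<le> ennreal B * ennreal (norm (\<sigma> w))"
            using True A_pos[OF w] B_pos by (simp add: ennreal_mult[symmetric] ennreal_leI)
        qed
        then have "(\<integral>\<^sup>+w. ennreal (norm (\<sigma> w) * (A w powr (1 - 2 / enn2real p) * norm (K w y))) \<partial>N)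
            \<le> (\<integral>\<^sup>+w. ennreal B * ennreal (norm (\<sigma> w)) \<partial>N)"
          by (rule nn_integral_mono_AE)
        also have "\<dots> = ennreal (B * m)"
          using B_pos m by (simp add: nn_integral_cmult ennreal_mult)
        finally show ?case .
      qed
    qed
  next
    case False
    define q where "q = enn2real p"
    have q: "1 \<le> q" unfolding q_def using p False by (rule enn2real_ge_1)
    define G where "G w y = A w powr (1 - 2 / q) * norm (K w y)" for w y
    have G0: "0 \<le> G w y" for w y by (simp add: G_def)
    have [measurable]: "(\<lambda>x. G (snd x) (fst x)) \<in> borel_measurable (M \<Otimes>\<^sub>M N)"
      unfolding G_def by measurable
    define J where "J y = (\<integral>\<^sup>+w. ennreal (G w y powr q * norm (\<sigma> w)) \<partial>N)" for y
    have J_meas[measurable]: "J \<in> borel_measurable M"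
      unfolding J_def by measurable
    have G_Lq: "(\<integral>\<^sup>+y. ennreal (G w y powr q) \<partial>M) \<le> ennreal (B powr q)" if w: "w \<in> space N" for w
    proof -
      have [measurable]: "K w \<in> borel_measurable M" using K_measurable_snd[OF w] .
      have Aw: "0 < A w" using A_pos[OF w] .
      define c where "c = A w powr (q - 2) * (B / A w) powr (q - 1)"
      have "AE y in M. ennreal (G w y powr q) \<le> ennreal c * ennreal (norm (K w y))"
        using K_bounded[OF w]
      proof eventually_elim
        case (elim y)
        have "G w y powr q = A w powr (q - 2) * norm (K w y) powr q"
          using q by (simp add: G_def powr_mult powr_powr left_diff_distrib)
        also have "norm (K w y) powr q = norm (K w y) powr (q - 1) * norm (K w y)"
          using powr_add[of "norm (K w y)" "q - 1" 1] by simp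
        also have "\<dots> \<le> (B / A w) powr (q - 1) * norm (K w y)"
          using elim q by (intro mult_right_mono powr_mono2) auto
        finally have "G w y powr q \<le> c * norm (K w y)"
          by (simp add: c_def mult.assoc mult_left_mono)
        then show ?case
          by (simp add: c_def ennreal_mult[symmetric] ennreal_leI)
      qed
      then have "(\<integral>\<^sup>+y. ennreal (G w y powr q) \<partial>M) \<le> (\<integral>\<^sup>+y. ennreal c * ennreal (norm (K w y)) \<partial>M)"
        by (rule nn_integral_mono_AE)
      also have "\<dots> \<le> ennreal c * ennreal (B * A w)"
        by (subst nn_integral_cmult) (auto intro!: mult_left_mono K_L1 w)
      also have "\<dots> = ennreal (c * (B * A w))"
        using B_pos Aw by (simp add: c_def ennreal_mult[symmetric])
      also have "c * (B * A w) = B powr q"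
      proof -
        have "(B / A w) powr (q - 1) = B powr (q - 1) * A w powr (1 - q)"
          using B_pos Aw powr_minus_divide[of "A w" "q - 1"] by (simp add: powr_divide)
        then have "c * (B * A w) = (A w powr (q - 2) * A w powr (1 - q) * A w powr 1) * (B powr (q - 1) * B powr 1)"
          using B_pos Aw by (simp add: c_def)
        also have "\<dots> = B powr q"
          using Aw by (simp only: powr_add[symmetric]) simp
        finally show ?thesis .
      qed
      finally show ?thesis .
    qed
    interpret P: pair_sigma_finite M N by unfold_locales
    have "(\<integral>\<^sup>+y. J y \<partial>M) = (\<integral>\<^sup>+w. \<integral>\<^sup>+y. ennreal (G w y powr q * norm (\<sigma> w)) \<partial>M \<partial>N)"
      unfolding J_def by (rule P.Fubini'[symmetric]) measurable
    also have "\<dots> \<le> (\<integral>\<^sup>+w. ennreal (B powr q) * ennreal (norm (\<sigma> w)) \<partial>N)"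
    proof (rule nn_integral_mono)
      fix w assume w: "w \<in> space N"
      have [measurable]: "K w \<in> borel_measurable M" using K_measurable_snd[OF w] .
      have [measurable]: "G w \<in> borel_measurable M" unfolding G_def by measurable
      have "(\<integral>\<^sup>+y. ennreal (G w y powr q * norm (\<sigma> w)) \<partial>M)
          = (\<integral>\<^sup>+y. ennreal (G w y powr q) \<partial>M) * ennreal (norm (\<sigma> w))"
        by (subst nn_integral_multc[symmetric]) (auto simp: ennreal_mult)
      also have "\<dots> \<le> ennreal (B powr q) * ennreal (norm (\<sigma> w))"
        by (intro mult_right_mono G_Lq w) auto
      finally show "(\<integral>\<^sup>+y. ennreal (G w y powr q * norm (\<sigma> w)) \<partial>M)
          \<le> ennreal (B powr q) * ennreal (norm (\<sigma> w))" .
    qed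
    also have "\<dots> = ennreal (B powr q * m)"
      using m by (simp add: nn_integral_cmult ennreal_mult)
    finally have J_int: "(\<integral>\<^sup>+y. J y \<partial>M) < \<infinity>"
      by (simp add: le_less_trans)
    have J_fin: "AE y in M. J y \<noteq> \<infinity>"
      using J_int by (intro nn_integral_noteq_infinite) auto
    have J_integrable: "integrable M (\<lambda>y. enn2real (J y))"
    proof (rule integrableI_bounded)
      have "(\<integral>\<^sup>+y. ennreal (norm (enn2real (J y))) \<partial>M) \<le> (\<integral>\<^sup>+y. J y \<partial>M)"
        by (intro nn_integral_mono) (simp add: ennreal_enn2real_if)
      then show "(\<integral>\<^sup>+y. ennreal (norm (enn2real (J y))) \<partial>M) < \<infinity>"
        using J_int by (rule le_less_trans)
    qed measurable
    define D where "D y = (m + 1) * enn2real (J y) powr (1 / q)" for y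
    show thesis
    proof (rule that[of D])
      show D0: "0 \<le> D y" for y using m by (simp add: D_def)
      have "norm (complex_of_real (D y)) powr q = (m + 1) powr q * enn2real (J y)" for y
      proof -
        have "norm (complex_of_real (D y)) powr q = D y powr q" using D0[of y] by simp
        also have "\<dots> = (m + 1) powr q * enn2real (J y)"
          using m q by (simp add: D_def powr_mult powr_powr)
        finally show ?thesis .
      qed
      then have "integrable M (\<lambda>y. norm (complex_of_real (D y)) powr q)"
        using J_integrable by simp
      then show "(\<lambda>y. complex_of_real (D y)) \<in> Lp_space M p"
        using False by (simp add: Lp_space_def q_def[symmetric] D_def)
      show "AE y in M. (\<integral>\<^sup>+w. ennreal (norm (\<sigma> w) * (A w powr (1 - 2 / enn2real p) * norm (K w y))) \<partial>N)
          \<le> ennreal (D y)"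
        using J_fin AE_space
      proof eventually_elim
        case (elim y)
        have [measurable]: "(\<lambda>w. G w y) \<in> borel_measurable N"
          unfolding G_def using K_measurable_fst[OF elim(2)] by measurable
        define j where "j = enn2real (J y)"
        have j: "J y = ennreal j" "0 \<le> j" using elim(1) by (auto simp: j_def less_top)
        have "(\<integral>\<^sup>+w. ennreal (G w y * norm (\<sigma> w)) \<partial>N) \<le> ennreal ((m + 1) * j powr (1 / q))"
        proof (cases "j = 0")
          case True
          then have "J y = 0" using j by simp
          then have "AE w in N. ennreal (G w y powr q * norm (\<sigma> w)) = 0"
            unfolding J_def by (subst (asm) nn_integral_0_iff_AE) measurable
          then have "AE w in N. ennreal (G w y * norm (\<sigma> w)) = 0"
            by eventually_elim (auto simp: ennreal_eq_0_iff G0 mult_le_0_iff)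
          then have "(\<integral>\<^sup>+w. ennreal (G w y * norm (\<sigma> w)) \<partial>N) = 0"
            by (subst nn_integral_0_iff_AE) measurable
          then show ?thesis by simp
        next
          case False
          then have "0 < j" using j by simp
          \<comment> \<open>Again the balancing choice: both terms of the split become multiples of \<open>j\<^bsup>1/q\<^esup>\<close>.\<close>
          define l where "l = j powr (1 / q)"
          have l: "0 < l" using \<open>0 < j\<close> by (simp add: l_def)
          have lj: "l powr (1 - q) * j = l"
          proof -
            have "l powr (1 - q) * j = j powr ((1 / q) * (1 - q) + 1)"
              unfolding l_def powr_powr powr_add using \<open>0 < j\<close> by simp
            also have "(1 / q) * (1 - q) + 1 = 1 / q" using q by (simp add: field_simps)
            finally show ?thesis by (simp add: l_def)
          qed
          have "(\<integral>\<^sup>+w. ennreal (G w y * norm (\<sigma> w)) \<partial>N)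
            \<le> ennreal l * (\<integral>\<^sup>+w. ennreal (norm (\<sigma> w)) \<partial>N)
              + ennreal (l powr (1 - q)) * (\<integral>\<^sup>+w. ennreal (G w y powr q * norm (\<sigma> w)) \<partial>N)"
            using l q G0 by (intro nn_integral_mult_le_split) auto
          also have "\<dots> = ennreal l * ennreal m + ennreal (l powr (1 - q)) * ennreal j"
            by (simp only: m(2) J_def[symmetric] j(1))
          also have "\<dots> = ennreal (l * m + l powr (1 - q) * j)"
            using l m j by (simp add: ennreal_mult[symmetric] ennreal_plus[symmetric] del: ennreal_plus)
          also have "l * m + l powr (1 - q) * j = (m + 1) * l"
            unfolding lj by (simp add: algebra_simps)
          finally show ?thesis by (simp add: l_def)
        qed
        then show ?case by (simp add: D_def j_def G_def q_def mult.commute mult.left_commute)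
      qed
    qed
  qed
qed

end

section \<open>Two-window localization operators\<close>

locale two_window_localization =
  ana: window_family M N \<Phi> A B + syn: window_family M N \<Psi> A B
  for M :: "'a measure" and N :: "'b measure" and \<Phi> \<Psi> :: "'b \<Rightarrow> 'a \<Rightarrow> complex"
    and A :: "'b \<Rightarrow> real" and B :: real +
  fixes \<sigma> :: "'b \<Rightarrow> complex"
  assumes \<sigma>_integrable: "integrable N \<sigma>"
begin

definition analysis :: "('a \<Rightarrow> complex) \<Rightarrow> 'b \<Rightarrow> complex" where
  "analysis f w = (\<integral>z. f z * cnj (\<Phi> w z) \<partial>M)"

definition synthesis :: "('b \<Rightarrow> complex) \<Rightarrow> 'a \<Rightarrow> complex" where
  "synthesis h y = (\<integral>w. \<sigma> w * h w * \<Psi> w y \<partial>N)"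

lemma \<sigma>_measurable[measurable]: "\<sigma> \<in> borel_measurable N"
  using \<sigma>_integrable by auto

lemma analysis_borel_measurable:
  "f \<in> Lp_space M p \<Longrightarrow> analysis f \<in> borel_measurable N"
  unfolding analysis_def using ana.analysis_measurable Lp_space_measurable by blast

lemma synthesis_borel_measurable:
  assumes [measurable]: "h \<in> borel_measurable N"
  shows "synthesis h \<in> borel_measurable M"
  unfolding synthesis_def by (rule syn.synthesis_measurable) measurable

lemma analysis_bounded:
  assumes "f \<in> Lp_space M p" "1 \<le> p" "Lp_norm M p f \<le> c" "w \<in> space N"
  shows "norm (analysis f w) \<le> B * (1 + c + c powr enn2real p) * A w powr (1 - 2 / enn2real p)"
  unfolding analysis_def by (rule ana.norm_analysis_le[OF assms])

text \<open>
  The number \<open>D\<close> is to be a value \<open>D y\<close> of the majorant from \<open>synthesis_dominated\<close>; this is the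
  pointwise form in which that majorant is used.
\<close>
lemma synthesis_bounded:
  assumes h: "h \<in> borel_measurable N"
    "\<And>w. w \<in> space N \<Longrightarrow> norm (h w) \<le> c * A w powr (1 - 2 / enn2real p)" and c: "0 \<le> c"
    and y: "y \<in> space M" and D: "0 \<le> D"
    "(\<integral>\<^sup>+w. ennreal (norm (\<sigma> w) * (A w powr (1 - 2 / enn2real p) * norm (\<Psi> w y))) \<partial>N) \<le> ennreal D"
  shows "integrable N (\<lambda>w. \<sigma> w * h w * \<Psi> w y)" "norm (synthesis h y) \<le> c * D"
proof -
  note [measurable] = h(1) syn.K_measurable_fst[OF y]
  have "(\<integral>\<^sup>+w. ennreal (norm (\<sigma> w * h w * \<Psi> w y)) \<partial>N)
      \<le> (\<integral>\<^sup>+w. ennreal c * ennreal (norm (\<sigma> w) * (A w powr (1 - 2 / enn2real p) * norm (\<Psi> w y))) \<partial>N)"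
  proof (rule nn_integral_mono)
    fix w assume w: "w \<in> space N"
    have "norm (\<sigma> w * h w * \<Psi> w y) = norm (\<sigma> w) * norm (h w) * norm (\<Psi> w y)"
      by (simp add: norm_mult)
    also have "\<dots> \<le> norm (\<sigma> w) * (c * A w powr (1 - 2 / enn2real p)) * norm (\<Psi> w y)"
      by (intro mult_left_mono mult_right_mono h w) auto
    also have "\<dots> = c * (norm (\<sigma> w) * (A w powr (1 - 2 / enn2real p) * norm (\<Psi> w y)))"
      by (simp add: mult_ac)
    finally show "ennreal (norm (\<sigma> w * h w * \<Psi> w y))
        \<le> ennreal c * ennreal (norm (\<sigma> w) * (A w powr (1 - 2 / enn2real p) * norm (\<Psi> w y)))"
      using c by (simp add: ennreal_mult[symmetric] ennreal_leI)
  qed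
  also have "\<dots> \<le> ennreal c * ennreal D"
    by (subst nn_integral_cmult) (auto intro!: mult_left_mono D)
  also have "\<dots> = ennreal (c * D)" using c D by (simp add: ennreal_mult)
  finally have le: "(\<integral>\<^sup>+w. ennreal (norm (\<sigma> w * h w * \<Psi> w y)) \<partial>N) \<le> ennreal (c * D)" .
  then show int: "integrable N (\<lambda>w. \<sigma> w * h w * \<Psi> w y)"
    by (auto simp: integrable_iff_bounded intro: le_less_trans)
  have "ennreal (norm (synthesis h y)) \<le> ennreal (c * D)"
    unfolding synthesis_def using integral_norm_bound_ennreal[OF int] le by (rule order_trans)
  then show "norm (synthesis h y) \<le> c * D"
    using c D by (simp add: ennreal_le_iff)
qed

lemma synthesis_in_Lp:
  assumes h: "h \<in> borel_measurable N"
    "\<And>w. w \<in> space N \<Longrightarrow> norm (h w) \<le> c * A w powr (1 - 2 / enn2real p)" and c: "0 \<le> c"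
    and p: "1 \<le> p"
  shows "synthesis h \<in> Lp_space M p"
proof -
  obtain D where D: "\<And>y. 0 \<le> D y" "(\<lambda>y. complex_of_real (D y)) \<in> Lp_space M p"
    "AE y in M. (\<integral>\<^sup>+w. ennreal (norm (\<sigma> w) * (A w powr (1 - 2 / enn2real p) * norm (\<Psi> w y))) \<partial>N)
       \<le> ennreal (D y)"
    using syn.synthesis_dominated[OF \<sigma>_integrable p] by blast
  show ?thesis
  proof (rule Lp_space_dominated[OF D(2) _ _ c])
    show "synthesis h \<in> borel_measurable M" by (rule synthesis_borel_measurable[OF h(1)])
    show "AE y in M. norm (synthesis h y) \<le> c * norm (complex_of_real (D y))"
      using D(3) AE_space
      by eventually_elim (use synthesis_bounded(2)[OF h c _ D(1)] D(1) in auto)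
  qed
qed

lemma bound_nonneg: "0 \<le> c \<Longrightarrow> 0 \<le> B * (1 + c + c powr q)"
  using ana.B_pos by simp

lemma linear_operator:
  assumes p: "1 \<le> p"
  shows "linear_operator_Lp M p (\<lambda>f. synthesis (analysis f))"
  unfolding linear_operator_Lp_def
proof (intro conjI ballI impI allI)
  obtain D where D: "\<And>y. 0 \<le> D y" "(\<lambda>y. complex_of_real (D y)) \<in> Lp_space M p"
    "AE y in M. (\<integral>\<^sup>+w. ennreal (norm (\<sigma> w) * (A w powr (1 - 2 / enn2real p) * norm (\<Psi> w y))) \<partial>N)
       \<le> ennreal (D y)"
    using syn.synthesis_dominated[OF \<sigma>_integrable p] by blast
  fix f assume f: "f \<in> Lp_space M p"
  note bnd = analysis_bounded[OF _ p order_refl]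
  show "synthesis (analysis f) \<in> Lp_space M p"
    by (rule synthesis_in_Lp[OF analysis_borel_measurable[OF f] bnd[OF f] bound_nonneg[OF Lp_norm_nonneg] p])
  {
    fix c
    have "analysis (\<lambda>z. c * f z) w = c * analysis f w" for w
      unfolding analysis_def by (simp add: mult.assoc)
    then have "synthesis (analysis (\<lambda>z. c * f z)) y = c * synthesis (analysis f) y" for y
      unfolding synthesis_def by (simp add: mult_ac)
    then show "AE x in M. synthesis (analysis (\<lambda>z. c * f z)) x = c * synthesis (analysis f) x"
      by simp
  }
  fix g assume g: "g \<in> Lp_space M p"
  {
    assume fg: "AE x in M. f x = g x"
    have "analysis f w = analysis g w" if w: "w \<in> space N" for w
    proof -
      note [measurable] = Lp_space_measurable[OF f] Lp_space_measurable[OF g] ana.K_measurable_snd[OF w]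
      show ?thesis
        unfolding analysis_def by (rule integral_cong_AE) (use fg in auto)
    qed
    then have "synthesis (analysis f) y = synthesis (analysis g) y" for y
      unfolding synthesis_def by (intro Bochner_Integration.integral_cong) auto
    then show "AE x in M. synthesis (analysis f) x = synthesis (analysis g) x" by simp
  }
  have add: "analysis (\<lambda>z. f z + g z) w = analysis f w + analysis g w" if w: "w \<in> space N" for w
    unfolding analysis_def
    using ana.analysis_integrable[OF f p w] ana.analysis_integrable[OF g p w]
    by (simp add: distrib_right)
  show "AE x in M. synthesis (analysis (\<lambda>z. f z + g z)) x
      = synthesis (analysis f) x + synthesis (analysis g) x"
    using D(3) AE_space
  proof eventually_elim
    case (elim y)
    have int: "integrable N (\<lambda>w. \<sigma> w * analysis u w * \<Psi> w y)" if u: "u \<in> Lp_space M p" for u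
      by (rule synthesis_bounded(1)[OF analysis_borel_measurable[OF u] bnd[OF u]
            bound_nonneg[OF Lp_norm_nonneg] elim(2) D(1) elim(1)])
    have "synthesis (analysis (\<lambda>z. f z + g z)) y
        = (\<integral>w. \<sigma> w * analysis f w * \<Psi> w y + \<sigma> w * analysis g w * \<Psi> w y \<partial>N)"
      unfolding synthesis_def
      by (intro Bochner_Integration.integral_cong) (auto simp: add algebra_simps)
    also have "\<dots> = synthesis (analysis f) y + synthesis (analysis g) y"
      unfolding synthesis_def by (rule Bochner_Integration.integral_add[OF int[OF f] int[OF g]])
    finally show ?case .
  qed
qed

text \<open>
  The coefficients \<open>analysis (F n)\<close>, divided by \<open>A\<^bsup>1-2/p\<^esup>\<close>, are uniformly bounded functions on the
  parameter space.  Along a weakly convergent subsequence the images converge at almost every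
  point, since the value at \<open>y\<close> is a pairing with an integrable function of \<open>w\<close>; the majorant in
  \<open>L\<^sup>p\<close> turns this into convergence in norm.
\<close>
lemma convergent_image_finite_exponent:
  assumes cg: "countably_generated N" and p: "1 \<le> p" "p \<noteq> \<infinity>"
    and F: "\<And>n. F n \<in> Lp_space M p" "\<And>n. Lp_norm M p (F n) \<le> C"
  obtains r g where "strict_mono (r :: nat \<Rightarrow> nat)" "g \<in> Lp_space M p"
    "(\<lambda>n. Lp_norm M p (\<lambda>y. synthesis (analysis (F (r n))) y - g y)) \<longlonglongrightarrow> 0"
proof -
  define q where "q = enn2real p"
  have q: "1 \<le> q" unfolding q_def using p by (rule enn2real_ge_1)
  define c where "c = B * (1 + C + C powr q)"
  have "0 \<le> C" using order_trans[OF Lp_norm_nonneg F(2)] .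
  then have c: "0 \<le> c" unfolding c_def by (rule bound_nonneg)
  have bnd: "norm (analysis (F n) w) \<le> c * A w powr (1 - 2 / q)" if "w \<in> space N" for n w
    unfolding c_def q_def by (rule analysis_bounded[OF F(1) p(1) F(2) that])
  note meas[measurable] = analysis_borel_measurable[OF F(1)]
  define T where "T n = synthesis (analysis (F n))" for n
  have T_meas[measurable]: "T n \<in> borel_measurable M" for n
    unfolding T_def by (rule synthesis_borel_measurable) measurable
  obtain D where D: "\<And>y. 0 \<le> D y" "(\<lambda>y. complex_of_real (D y)) \<in> Lp_space M p"
    "AE y in M. (\<integral>\<^sup>+w. ennreal (norm (\<sigma> w) * (A w powr (1 - 2 / q) * norm (\<Psi> w y))) \<partial>N)
       \<le> ennreal (D y)"
    unfolding q_def using syn.synthesis_dominated[OF \<sigma>_integrable p(1)] by blast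
  define h where "h n w = analysis (F n) w * complex_of_real (A w powr - (1 - 2 / q))" for n w
  have h_meas: "h n \<in> borel_measurable N" for n unfolding h_def by measurable
  have A_cancel: "A w powr - (1 - 2 / q) * A w powr (1 - 2 / q) = 1" if "w \<in> space N" for w
    using syn.A_pos[OF that] by (simp only: powr_add[symmetric]) simp
  have h_bounded: "AE w in N. norm (h n w) \<le> c" for n
  proof (rule AE_I2)
    fix w assume w: "w \<in> space N"
    have "norm (h n w) = norm (analysis (F n) w) * A w powr - (1 - 2 / q)"
      by (simp add: h_def norm_mult)
    also have "\<dots> \<le> (c * A w powr (1 - 2 / q)) * A w powr - (1 - 2 / q)"
      by (intro mult_right_mono bnd w) auto
    also have "\<dots> = c" using A_cancel[OF w] by (simp add: mult_ac)
    finally show "norm (h n w) \<le> c" .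
  qed
  obtain r where r: "strict_mono (r :: nat \<Rightarrow> nat)"
    "\<And>g. integrable N g \<Longrightarrow> convergent (\<lambda>n. \<integral>w. h (r n) w * g w \<partial>N)"
    by (rule ana.N.weakly_convergent_subsequence[of h c, OF cg h_meas h_bounded]) blast
  have conv: "AE y in M. convergent (\<lambda>n. T (r n) y)"
    using D(3) AE_space
  proof eventually_elim
    case (elim y)
    note [measurable] = syn.K_measurable_fst[OF elim(2)]
    let ?g = "\<lambda>w. \<sigma> w * complex_of_real (A w powr (1 - 2 / q)) * \<Psi> w y"
    have "integrable N ?g"
      by (rule synthesis_bounded(1)[where p=p and c=1 and D="D y"])
        (use elim D(1) in \<open>auto simp: q_def\<close>)
    from r(2)[OF this] have "convergent (\<lambda>n. \<integral>w. h (r n) w * ?g w \<partial>N)" .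
    moreover have "(\<integral>w. h (r n) w * ?g w \<partial>N) = T (r n) y" for n
      unfolding T_def synthesis_def
    proof (rule Bochner_Integration.integral_cong[OF refl])
      fix w assume w: "w \<in> space N"
      have "h (r n) w * ?g w = \<sigma> w * analysis (F (r n)) w * \<Psi> w y
          * complex_of_real (A w powr - (1 - 2 / q) * A w powr (1 - 2 / q))"
        by (simp add: h_def mult_ac)
      then show "h (r n) w * ?g w = \<sigma> w * analysis (F (r n)) w * \<Psi> w y"
        by (simp only: A_cancel[OF w] of_real_1 mult_1_right)
    qed
    ultimately show ?case by simp
  qed
  have dom: "AE y in M. \<forall>n. norm (T n y) \<le> c * D y"
    using D(3) AE_space
  proof eventually_elim
    case (elim y)
    show ?case
      unfolding T_def
      using synthesis_bounded(2)[OF meas bnd[unfolded q_def] c elim(2) D(1) elim(1)[unfolded q_def]] by blast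
  qed
  define g where "g y = lim (\<lambda>n. T (r n) y)" for y
  have g_meas[measurable]: "g \<in> borel_measurable M"
    unfolding g_def by (rule borel_measurable_lim_metric) measurable
  have g_lim: "AE y in M. (\<lambda>n. T (r n) y) \<longlonglongrightarrow> g y"
    using conv by eventually_elim (simp add: g_def convergent_LIMSEQ_iff)
  have g_dom: "AE y in M. norm (g y) \<le> c * D y"
    using g_lim dom
  proof eventually_elim
    case (elim y)
    then show ?case by (intro tendsto_upperbound[OF tendsto_norm[OF elim(1)]]) auto
  qed
  have g_Lp: "g \<in> Lp_space M p"
    by (rule Lp_space_dominated[OF D(2) g_meas _ c]) (use g_dom D(1) in auto)
  have Dq: "integrable M (\<lambda>y. (2 * c * D y) powr q)"
  proof -
    have "integrable M (\<lambda>y. (2 * c) powr q * norm (complex_of_real (D y)) powr q)"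
      using Lp_space_finite_integrable[OF D(2) p(2)] by (simp add: q_def)
    then show ?thesis using D(1) c by (simp add: powr_mult)
  qed
  have "(\<lambda>n. \<integral>y. norm (T (r n) y - g y) powr q \<partial>M) \<longlonglongrightarrow> (\<integral>y. 0 \<partial>M)"
  proof (rule integral_dominated_convergence[OF _ _ Dq])
    show "AE y in M. (\<lambda>n. norm (T (r n) y - g y) powr q) \<longlonglongrightarrow> 0"
      using g_lim
    proof eventually_elim
      case (elim y)
      then have "(\<lambda>n. norm (T (r n) y - g y)) \<longlonglongrightarrow> 0" by (intro tendsto_norm_zero LIM_zero)
      then show ?case using q by (intro tendsto_zero_powrI[where b=q]) auto
    qed
    show "AE y in M. norm (norm (T (r n) y - g y) powr q) \<le> (2 * c * D y) powr q" for n
      using dom g_dom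
    proof eventually_elim
      case (elim y)
      have "norm (T (r n) y - g y) \<le> 2 * c * D y"
        using norm_triangle_ineq4[of "T (r n) y" "g y"] elim(1)[rule_format, of "r n"] elim(2)
        by linarith
      then show ?case using q by (auto intro!: powr_mono2)
    qed
  qed measurable
  then have "(\<lambda>n. (\<integral>y. norm (T (r n) y - g y) powr q \<partial>M) powr (1 / q)) \<longlonglongrightarrow> 0"
    using q by (intro tendsto_zero_powrI[where b="1 / q"]) auto
  then have "(\<lambda>n. Lp_norm M p (\<lambda>y. T (r n) y - g y)) \<longlonglongrightarrow> 0"
    using p(2) by (simp add: Lp_norm_def q_def)
  with r(1) g_Lp show ?thesis unfolding T_def by (rule that)
qed

text \<open>
  Dominated convergence in \<open>y\<close> is of no use for the supremum norm.  Instead the subsequence is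
  taken weakly convergent on \<open>M\<close>, so that \<open>analysis (F n) w\<close> converges for every \<open>w\<close>, and
  dominated convergence in \<open>w\<close> gives an error \<open>e n\<close> that does not depend on \<open>y\<close>.
\<close>
lemma convergent_image_infinite_exponent:
  assumes cg: "countably_generated M"
    and F: "\<And>n. F n \<in> Lp_space M \<infinity>" "\<And>n. Lp_norm M \<infinity> (F n) \<le> C"
  obtains r g where "strict_mono (r :: nat \<Rightarrow> nat)" "g \<in> Lp_space M \<infinity>"
    "(\<lambda>n. Lp_norm M \<infinity> (\<lambda>y. synthesis (analysis (F (r n))) y - g y)) \<longlonglongrightarrow> 0"
proof -
  have p: "1 \<le> (\<infinity> :: ennreal)" by simp
  define c where "c = B * (1 + C + C powr enn2real \<infinity>)"
  have "0 \<le> C" using order_trans[OF Lp_norm_nonneg F(2)] .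
  then have c: "0 \<le> c" unfolding c_def by (rule bound_nonneg)
  have bnd: "norm (analysis (F n) w) \<le> c * A w powr (1 - 2 / enn2real \<infinity>)" if "w \<in> space N" for n w
    unfolding c_def by (rule analysis_bounded[OF F(1) p F(2) that])
  note meas[measurable] = analysis_borel_measurable[OF F(1)]
  have "AE x in M. norm (F n x) \<le> C" for n
    using Lp_space_infinity_AE[OF F(1)[of n]] F(2)[of n] by (auto elim!: eventually_mono)
  from ana.M.weakly_convergent_subsequence[of F C, OF cg Lp_space_measurable[OF F(1)] this]
  obtain r where r: "strict_mono (r :: nat \<Rightarrow> nat)"
    "\<And>g. integrable M g \<Longrightarrow> convergent (\<lambda>n. \<integral>x. F (r n) x * g x \<partial>M)" by blast
  define h where "h w = lim (\<lambda>n. analysis (F (r n)) w)" for w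
  have h_meas[measurable]: "h \<in> borel_measurable N"
    unfolding h_def by (rule borel_measurable_lim_metric) measurable
  have h_lim: "(\<lambda>n. analysis (F (r n)) w) \<longlonglongrightarrow> h w" if w: "w \<in> space N" for w
  proof -
    have "integrable M (\<lambda>z. cnj (\<Phi> w z))" using ana.K_integrable[OF w] by simp
    from r(2)[OF this] show ?thesis by (simp add: h_def analysis_def convergent_LIMSEQ_iff)
  qed
  have h_bnd: "norm (h w) \<le> c * A w powr (1 - 2 / enn2real \<infinity>)" if w: "w \<in> space N" for w
    using bnd[OF w] by (intro tendsto_upperbound[OF tendsto_norm[OF h_lim[OF w]]]) auto
  have g_Lp: "synthesis h \<in> Lp_space M \<infinity>"
    by (rule synthesis_in_Lp[OF h_meas h_bnd c p])
  obtain D where D: "\<And>y. 0 \<le> D y" "(\<lambda>y. complex_of_real (D y)) \<in> Lp_space M \<infinity>"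
    "AE y in M. (\<integral>\<^sup>+w. ennreal (norm (\<sigma> w) * (A w powr (1 - 2 / enn2real \<infinity>) * norm (\<Psi> w y))) \<partial>N)
       \<le> ennreal (D y)"
    using syn.synthesis_dominated[OF \<sigma>_integrable p] by blast
  define e where "e n = (\<integral>w. B * (norm (\<sigma> w) * (norm (analysis (F (r n)) w - h w) / A w)) \<partial>N)" for n
  have e_bnd: "norm (B * (norm (\<sigma> w) * (norm (analysis (F (r n)) w - h w) / A w))) \<le> B * (2 * c) * norm (\<sigma> w)"
    if w: "w \<in> space N" for n w
  proof -
    have Aw: "0 < A w" using syn.A_pos[OF w] .
    have "norm (analysis (F (r n)) w - h w) \<le> (2 * c) * A w"
      using norm_triangle_ineq4[of "analysis (F (r n)) w" "h w"] bnd[OF w, of "r n"] h_bnd[OF w] Aw by simp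
    then have "norm (analysis (F (r n)) w - h w) / A w \<le> 2 * c" using Aw by (simp add: field_simps)
    then have "norm (\<sigma> w) * (norm (analysis (F (r n)) w - h w) / A w) \<le> norm (\<sigma> w) * (2 * c)"
      by (rule mult_left_mono) simp
    then have "B * (norm (\<sigma> w) * (norm (analysis (F (r n)) w - h w) / A w)) \<le> B * (norm (\<sigma> w) * (2 * c))"
      by (rule mult_left_mono) (use syn.B_pos in simp)
    then show ?thesis using syn.B_pos Aw by (simp add: abs_mult mult_ac)
  qed
  have e_int: "integrable N (\<lambda>w. B * (norm (\<sigma> w) * (norm (analysis (F (r n)) w - h w) / A w)))" for n
  proof (rule Bochner_Integration.integrable_bound[where f="\<lambda>w. B * (2 * c) * norm (\<sigma> w)"])
    show "AE w in N. norm (B * (norm (\<sigma> w) * (norm (analysis (F (r n)) w - h w) / A w)))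
        \<le> norm (B * (2 * c) * norm (\<sigma> w))"
      using e_bnd by (intro AE_I2 order_trans[OF e_bnd]) auto
  qed (use \<sigma>_integrable in auto)
  have "e \<longlonglongrightarrow> (\<integral>w. 0 \<partial>N)"
    unfolding e_def
  proof (rule integral_dominated_convergence[where w="\<lambda>w. B * (2 * c) * norm (\<sigma> w)"])
    show "AE w in N. (\<lambda>n. B * (norm (\<sigma> w) * (norm (analysis (F (r n)) w - h w) / A w))) \<longlonglongrightarrow> 0"
    proof (rule AE_I2)
      fix w assume "w \<in> space N"
      from tendsto_norm_zero[OF LIM_zero[OF h_lim[OF this]]]
      have "(\<lambda>n. B * (norm (\<sigma> w) * (norm (analysis (F (r n)) w - h w) / A w)))
          \<longlonglongrightarrow> B * (norm (\<sigma> w) * (0 / A w))"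
        unfolding divide_inverse by (intro tendsto_intros)
      then show "(\<lambda>n. B * (norm (\<sigma> w) * (norm (analysis (F (r n)) w - h w) / A w))) \<longlonglongrightarrow> 0" by simp
    qed
  qed (use \<sigma>_integrable e_bnd in \<open>auto intro!: AE_I2\<close>)
  then have e_lim: "e \<longlonglongrightarrow> 0" by simp
  have e0: "0 \<le> e n" for n
    unfolding e_def
    using syn.A_pos syn.B_pos by (intro Bochner_Integration.integral_nonneg) (auto intro!: mult_nonneg_nonneg divide_nonneg_nonneg simp: less_imp_le)
  have "Lp_norm M \<infinity> (\<lambda>y. synthesis (analysis (F (r n))) y - synthesis h y) \<le> e n" for n
  proof (rule Lp_norm_infinity_le[OF _ _ e0])
    show "(\<lambda>y. synthesis (analysis (F (r n))) y - synthesis h y) \<in> borel_measurable M"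
      by (intro borel_measurable_diff synthesis_borel_measurable) measurable
    show "AE y in M. norm (synthesis (analysis (F (r n))) y - synthesis h y) \<le> e n"
      using D(3) syn.K_bounded_swap AE_space
    proof eventually_elim
      case (elim y)
      note [measurable] = syn.K_measurable_fst[OF elim(3)]
      have i1: "integrable N (\<lambda>w. \<sigma> w * analysis (F (r n)) w * \<Psi> w y)"
        by (rule synthesis_bounded(1)[OF meas bnd c elim(3) D(1) elim(1)])
      have i2: "integrable N (\<lambda>w. \<sigma> w * h w * \<Psi> w y)"
        by (rule synthesis_bounded(1)[OF h_meas h_bnd c elim(3) D(1) elim(1)])
      have "synthesis (analysis (F (r n))) y - synthesis h y
          = (\<integral>w. \<sigma> w * (analysis (F (r n)) w - h w) * \<Psi> w y \<partial>N)"
        unfolding synthesis_def Bochner_Integration.integral_diff[OF i1 i2, symmetric]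
        by (intro Bochner_Integration.integral_cong) (auto simp: algebra_simps)
      also have "norm \<dots> \<le> (\<integral>w. norm (\<sigma> w * (analysis (F (r n)) w - h w) * \<Psi> w y) \<partial>N)"
        by (rule integral_norm_bound)
      also have "\<dots> \<le> e n"
        unfolding e_def
      proof (rule integral_mono_AE[OF _ e_int])
        have "integrable N (\<lambda>w. \<sigma> w * analysis (F (r n)) w * \<Psi> w y - \<sigma> w * h w * \<Psi> w y)"
          using i1 i2 by (rule Bochner_Integration.integrable_diff)
        then show "integrable N (\<lambda>w. norm (\<sigma> w * (analysis (F (r n)) w - h w) * \<Psi> w y))"
          by (intro integrable_norm) (simp add: algebra_simps)
        show "AE w in N. norm (\<sigma> w * (analysis (F (r n)) w - h w) * \<Psi> w y)
            \<le> B * (norm (\<sigma> w) * (norm (analysis (F (r n)) w - h w) / A w))"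
          using elim(2)
        proof eventually_elim
          case (elim w)
          have "norm (\<sigma> w * (analysis (F (r n)) w - h w) * \<Psi> w y)
              = (norm (\<sigma> w) * norm (analysis (F (r n)) w - h w)) * norm (\<Psi> w y)"
            by (simp add: norm_mult)
          also have "\<dots> \<le> (norm (\<sigma> w) * norm (analysis (F (r n)) w - h w)) * (B / A w)"
            using elim by (intro mult_left_mono) auto
          finally show ?case by (simp add: mult_ac)
        qed
      qed
      finally show ?case .
    qed
  qed
  then have "(\<lambda>n. Lp_norm M \<infinity> (\<lambda>y. synthesis (analysis (F (r n))) y - synthesis h y)) \<longlonglongrightarrow> 0"
    by (intro tendsto_sandwich[OF _ _ tendsto_const e_lim]) (auto simp: Lp_norm_nonneg)
  with r(1) g_Lp show ?thesis by (rule that)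
qed

theorem compact_operator:
  assumes "countably_generated M" "countably_generated N" "1 \<le> p"
  shows "compact_operator_Lp M p (\<lambda>f. synthesis (analysis f))"
  unfolding compact_operator_Lp_def
proof (intro conjI allI impI)
  show "linear_operator_Lp M p (\<lambda>f. synthesis (analysis f))"
    by (rule linear_operator[OF assms(3)])
  fix F C assume F: "\<forall>n::nat. F n \<in> Lp_space M p \<and> Lp_norm M p (F n) \<le> C"
  show "\<exists>r g. strict_mono r \<and> g \<in> Lp_space M p \<and>
      (\<lambda>n. Lp_norm M p (\<lambda>x. synthesis (analysis (F (r n))) x - g x)) \<longlonglongrightarrow> 0"
  proof (cases "p = \<infinity>")
    case True
    then show ?thesis
      using convergent_image_infinite_exponent[OF assms(1), of F C] F by blast
  next
    case False
    then show ?thesis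
      using convergent_image_finite_exponent[OF assms(2,3), of F C] F by blast
  qed
qed

end

section \<open>Polar coordinates in a weighted half-plane\<close>

text \<open>
  The half-line is exhausted by compact intervals, to which the substitution rule applies; the
  point \<open>0\<close> is negligible.
\<close>
lemma nn_integral_square_substitution:
  fixes f :: "real \<Rightarrow> ennreal"
  assumes [measurable]: "f \<in> borel_measurable borel"
  shows "(\<integral>\<^sup>+x. f x * indicator {0<..} x \<partial>lborel)
    = (\<integral>\<^sup>+t. f (t\<^sup>2) * ennreal (2 * t) * indicator {0<..} t \<partial>lborel)"
proof -
  define N where "N n = real (Suc n)" for n
  have N: "0 < N n" "incseq N" for n by (auto simp: N_def incseq_def)
  have unbounded: "\<exists>n. x \<le> N n" for x
    using real_arch_simple[of x] unfolding N_def by (metis Suc_leD le_refl of_nat_le_iff order_trans)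
  have ind_sup: "(SUP n. indicator {0..g n} x) = (indicator {0..} x :: ennreal)"
    if g: "\<And>x::real. \<exists>n::nat. x \<le> g n" for g and x :: real
  proof (intro antisym SUP_least)
    show "indicator {0..g n} x \<le> (indicator {0..} x :: ennreal)" for n
      by (auto simp: indicator_def)
    obtain n where "x \<le> g n" using g by blast
    then have "indicator {0..} x \<le> (indicator {0..g n} x :: ennreal)" by (auto simp: indicator_def)
    also have "\<dots> \<le> (SUP n. indicator {0..g n} x)" by (rule SUP_upper) simp
    finally show "indicator {0..} x \<le> (SUP n. indicator {0..g n} x :: ennreal)" .
  qed
  have lim: "(\<integral>\<^sup>+x. k x * indicator {0..} x \<partial>lborel) = (SUP n. \<integral>\<^sup>+x. k x * indicator {0..g n} x \<partial>lborel)"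
    if [measurable]: "k \<in> borel_measurable borel" and g: "incseq g" "\<And>x::real. \<exists>n::nat. x \<le> g n"
    for g and k :: "real \<Rightarrow> ennreal"
  proof -
    have "(\<integral>\<^sup>+x. k x * indicator {0..} x \<partial>lborel) = (\<integral>\<^sup>+x. (SUP n. k x * indicator {0..g n} x) \<partial>lborel)"
      unfolding SUP_mult_left_ennreal[symmetric] ind_sup[OF g(2)] ..
    also have "\<dots> = (SUP n. \<integral>\<^sup>+x. k x * indicator {0..g n} x \<partial>lborel)"
    proof (rule nn_integral_monotone_convergence_SUP)
      show "incseq (\<lambda>n x. k x * indicator {0..g n} x)"
        using g(1) by (auto simp: incseq_def le_fun_def indicator_def intro!: mult_left_mono)
          (meson order_trans)
    qed measurable
    finally show ?thesis .
  qed
  have half_open: "(\<integral>\<^sup>+x. k x * indicator {0<..} x \<partial>lborel) = (\<integral>\<^sup>+x. k x * indicator {0..} x \<partial>lborel)"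
    for k :: "real \<Rightarrow> ennreal"
    by (rule nn_integral_cong_AE, rule AE_mp[OF AE_lborel_singleton[of 0]])
      (auto simp: indicator_def)
  have on_interval: "(\<integral>\<^sup>+x. f x * indicator {0..(N n)\<^sup>2} x \<partial>lborel)
      = (\<integral>\<^sup>+t. f (t\<^sup>2) * ennreal (2 * t) * indicator {0..N n} t \<partial>lborel)" for n
  proof -
    have "(\<integral>\<^sup>+x. f x * indicator {0\<^sup>2..(N n)\<^sup>2} x \<partial>lborel)
        = (\<integral>\<^sup>+t. f (t\<^sup>2) * ennreal (2 * t) * indicator {0..N n} t \<partial>lborel)"
      by (rule nn_integral_substitution_aux)
        (use N(1)[of n] in \<open>auto intro!: derivative_eq_intros continuous_intros\<close>)
    then show ?thesis by simp
  qed
  have N2: "incseq (\<lambda>n. (N n)\<^sup>2)"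
    using N by (auto simp: incseq_def less_imp_le intro!: power_mono)
  have unbounded2: "\<exists>n. x \<le> (N n)\<^sup>2" for x
  proof -
    obtain n where "x \<le> N n" using unbounded by blast
    moreover have "N n * 1 \<le> N n * N n" by (intro mult_left_mono) (auto simp: N_def)
    ultimately show ?thesis by (intro exI[of _ n]) (simp add: power2_eq_square)
  qed
  have "(\<integral>\<^sup>+x. f x * indicator {0..} x \<partial>lborel)
      = (\<integral>\<^sup>+t. f (t\<^sup>2) * ennreal (2 * t) * indicator {0..} t \<partial>lborel)"
    unfolding lim[OF assms N2 unbounded2] on_interval
    by (rule lim[OF _ N(2) unbounded, symmetric]) measurable
  then show ?thesis by (simp only: half_open)
qed

lemma nn_integral_cos_substitution:
  fixes f :: "real \<Rightarrow> ennreal"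
  assumes [measurable]: "f \<in> borel_measurable borel" and t: "0 < t"
  shows "(\<integral>\<^sup>+\<theta>. f (t * cos \<theta>) * ennreal (t * sin \<theta>) * indicator {0..pi} \<theta> \<partial>lborel)
    = (\<integral>\<^sup>+u. f u * indicator {-t..t} u \<partial>lborel)"
proof -
  have "(\<integral>\<^sup>+u. f (- u) * indicator {- t * cos 0..- t * cos pi} u \<partial>lborel)
      = (\<integral>\<^sup>+\<theta>. f (- (- t * cos \<theta>)) * ennreal (t * sin \<theta>) * indicator {0..pi} \<theta> \<partial>lborel)"
    by (rule nn_integral_substitution_aux)
      (use t in \<open>auto intro!: derivative_eq_intros continuous_intros mult_nonneg_nonneg sin_ge_zero\<close>)
  moreover have "(\<integral>\<^sup>+u. f u * indicator {-t..t} u \<partial>lborel) = (\<integral>\<^sup>+u. f (- u) * indicator {-t..t} u \<partial>lborel)"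
    by (subst nn_integral_real_affine[where c="-1" and t=0])
      (auto simp: indicator_def minus_le_iff intro!: nn_integral_cong)
  ultimately show ?thesis by simp
qed

text \<open>
  Here \<open>u = t cos \<theta>\<close> is the horizontal coordinate of the point with polar coordinates \<open>(t, \<theta>)\<close>, and
  \<open>q = t\<^sup>2 - u\<^sup>2 = (t sin \<theta>)\<^sup>2\<close> is the square of its height; the measure
  \<open>t\<^bsup>2\<alpha>+1\<^esup> (sin \<theta>)\<^bsup>2\<alpha>\<^esup> dt d\<theta>\<close> becomes \<open>q\<^bsup>\<alpha>-1/2\<^esup>/2 dq du\<close>.  The change of variables is split into
  two one-dimensional ones, first \<open>\<theta>\<close> to \<open>u\<close> for fixed \<open>t\<close>, and then, after exchanging the
  integrals, \<open>t\<close> to \<open>q\<close> for fixed \<open>u\<close>; this avoids Jacobians.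
\<close>
lemma nn_integral_polar_half_plane:
  fixes F :: "real \<Rightarrow> real \<Rightarrow> ennreal"
  assumes F[measurable]: "(\<lambda>(t, u). F t u) \<in> borel_measurable (borel \<Otimes>\<^sub>M borel)"
  shows "(\<integral>\<^sup>+t. (\<integral>\<^sup>+\<theta>. F t (t * cos \<theta>) * ennreal (sin \<theta> powr (2 * \<alpha>)) * indicator {0..pi} \<theta> \<partial>lborel)
            * ennreal (t powr (2 * \<alpha> + 1)) * indicator {0<..} t \<partial>lborel)
    = (\<integral>\<^sup>+u. (\<integral>\<^sup>+q. F (sqrt (q + u\<^sup>2)) u * ennreal (q powr (\<alpha> - 1/2) / 2) * indicator {0<..} q \<partial>lborel) \<partial>lborel)"
proof -
  define W where "W t u = F t u * ennreal ((t\<^sup>2 - u\<^sup>2) powr (\<alpha> - 1/2) * t)" for t u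
  have [measurable]: "(\<lambda>x. F (fst x) (snd x)) \<in> borel_measurable (borel \<Otimes>\<^sub>M borel)"
    using F by (simp add: case_prod_beta')
  have F_comp[measurable]: "(\<lambda>x. F (a x) (b x)) \<in> borel_measurable M"
    if "a \<in> borel_measurable M" "b \<in> borel_measurable M" for a b and M :: "'x measure"
    using measurable_compose[OF measurable_Pair[OF that] F] by simp
  have angular: "(\<integral>\<^sup>+\<theta>. F t (t * cos \<theta>) * ennreal (sin \<theta> powr (2 * \<alpha>)) * indicator {0..pi} \<theta> \<partial>lborel)
        * ennreal (t powr (2 * \<alpha> + 1)) = (\<integral>\<^sup>+u. W t u * indicator {-t..t} u \<partial>lborel)" if t: "0 < t" for t
  proof -
    have [measurable]: "W t \<in> borel_measurable borel" unfolding W_def by measurable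
    have "(\<integral>\<^sup>+\<theta>. F t (t * cos \<theta>) * ennreal (sin \<theta> powr (2 * \<alpha>)) * indicator {0..pi} \<theta> \<partial>lborel)
        * ennreal (t powr (2 * \<alpha> + 1))
      = (\<integral>\<^sup>+\<theta>. F t (t * cos \<theta>) * ennreal (sin \<theta> powr (2 * \<alpha>)) * indicator {0..pi} \<theta>
        * ennreal (t powr (2 * \<alpha> + 1)) \<partial>lborel)"
      by (subst nn_integral_multc) measurable
    also have "\<dots> = (\<integral>\<^sup>+\<theta>. W t (t * cos \<theta>) * ennreal (t * sin \<theta>) * indicator {0..pi} \<theta> \<partial>lborel)"
    proof (rule nn_integral_cong)
      fix \<theta>
      have eq: "sin \<theta> powr (2 * \<alpha>) * t powr (2 * \<alpha> + 1)
          = ((t\<^sup>2 - (t * cos \<theta>)\<^sup>2) powr (\<alpha> - 1/2) * t) * (t * sin \<theta>)" if "\<theta> \<in> {0..pi}"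
      proof (cases "sin \<theta> = 0")
        case False
        then have s: "0 < sin \<theta>" using that by (simp add: less_le sin_ge_zero)
        have "t\<^sup>2 - (t * cos \<theta>)\<^sup>2 = t\<^sup>2 * (1 - (cos \<theta>)\<^sup>2)"
          by (simp add: power_mult_distrib right_diff_distrib)
        also have "\<dots> = (t * sin \<theta>)\<^sup>2" by (simp add: sin_squared_eq power_mult_distrib)
        also have "\<dots> = (t * sin \<theta>) powr 2" using s t by (simp add: powr_numeral)
        finally have "(t\<^sup>2 - (t * cos \<theta>)\<^sup>2) powr (\<alpha> - 1/2) = (t * sin \<theta>) powr (2 * (\<alpha> - 1/2))"
          by (simp only: powr_powr)
        then have "(t\<^sup>2 - (t * cos \<theta>)\<^sup>2) powr (\<alpha> - 1/2) * (t * sin \<theta>) = (t * sin \<theta>) powr (2 * (\<alpha> - 1/2)) * (t * sin \<theta>) powr 1"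
          using s t by simp
        also have "\<dots> = (t * sin \<theta>) powr (2 * \<alpha>)" by (simp only: powr_add[symmetric]) simp
        also have "\<dots> = t powr (2 * \<alpha>) * sin \<theta> powr (2 * \<alpha>)"
          using s t by (simp add: powr_mult)
        finally show ?thesis using t by (simp add: powr_add mult_ac)
      qed simp
      have "ennreal (sin \<theta> powr (2 * \<alpha>)) * ennreal (t powr (2 * \<alpha> + 1))
          = ennreal ((t\<^sup>2 - (t * cos \<theta>)\<^sup>2) powr (\<alpha> - 1/2) * t) * ennreal (t * sin \<theta>)" if "\<theta> \<in> {0..pi}"
        using eq[OF that] t that by (simp add: ennreal_mult[symmetric] sin_ge_zero)
      then show "F t (t * cos \<theta>) * ennreal (sin \<theta> powr (2 * \<alpha>)) * indicator {0..pi} \<theta> * ennreal (t powr (2 * \<alpha> + 1))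
          = W t (t * cos \<theta>) * ennreal (t * sin \<theta>) * indicator {0..pi} \<theta>"
        by (cases "\<theta> \<in> {0..pi}") (auto simp: W_def mult.assoc)
    qed
    also have "\<dots> = (\<integral>\<^sup>+u. W t u * indicator {-t..t} u \<partial>lborel)"
      by (rule nn_integral_cos_substitution[OF _ t]) measurable
    finally show ?thesis .
  qed
  have radial: "(\<integral>\<^sup>+t. W t u * indicator {-t..t} u * indicator {0<..} t \<partial>lborel)
      = (\<integral>\<^sup>+q. F (sqrt (q + u\<^sup>2)) u * ennreal (q powr (\<alpha> - 1/2) / 2) * indicator {0<..} q \<partial>lborel)" for u
  proof -
    define f where "f x = F (sqrt x) u * ennreal ((x - u\<^sup>2) powr (\<alpha> - 1/2) / 2) * indicator {u\<^sup>2<..} x" for x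
    have [measurable]: "f \<in> borel_measurable borel" unfolding f_def by measurable
    have "W t u * indicator {-t..t} u * indicator {0<..} t = f (t\<^sup>2) * ennreal (2 * t) * indicator {0<..} t" for t
    proof (cases "0 < t")
      case True
      have iff: "u \<in> {-t..t} \<longleftrightarrow> u\<^sup>2 \<le> t\<^sup>2" using True abs_le_square_iff[of u t] by auto
      then have ind: "indicator {-t..t} u = (if u\<^sup>2 \<le> t\<^sup>2 then 1 else 0 :: ennreal)"
        by (simp add: indicator_def)
      have "ennreal ((t\<^sup>2 - u\<^sup>2) powr (\<alpha> - 1/2) * t)
          = ennreal ((t\<^sup>2 - u\<^sup>2) powr (\<alpha> - 1/2) / 2) * ennreal (2 * t)"
        using True by (simp add: ennreal_mult[symmetric])
      then show ?thesis
        using True unfolding W_def f_def ind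
        by (cases "u\<^sup>2" "t\<^sup>2" rule: linorder_cases) (simp_all add: mult.assoc)
    qed simp
    then have "(\<integral>\<^sup>+t. W t u * indicator {-t..t} u * indicator {0<..} t \<partial>lborel)
        = (\<integral>\<^sup>+x. f x * indicator {0<..} x \<partial>lborel)"
      by (subst nn_integral_square_substitution) simp_all
    also have "\<dots> = (\<integral>\<^sup>+q. f (u\<^sup>2 + 1 * q) * indicator {0<..} (u\<^sup>2 + 1 * q) \<partial>lborel)"
      by (subst nn_integral_real_affine[where c=1 and t="u\<^sup>2"]) simp_all
    also have "\<dots> = (\<integral>\<^sup>+q. F (sqrt (q + u\<^sup>2)) u * ennreal (q powr (\<alpha> - 1/2) / 2) * indicator {0<..} q \<partial>lborel)"
      by (rule nn_integral_cong) (auto simp: f_def indicator_def add.commute add_pos_nonneg)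
    finally show ?thesis .
  qed
  have "(\<integral>\<^sup>+t. (\<integral>\<^sup>+\<theta>. F t (t * cos \<theta>) * ennreal (sin \<theta> powr (2 * \<alpha>)) * indicator {0..pi} \<theta> \<partial>lborel)
            * ennreal (t powr (2 * \<alpha> + 1)) * indicator {0<..} t \<partial>lborel)
      = (\<integral>\<^sup>+t. (\<integral>\<^sup>+u. W t u * indicator {-t..t} u * indicator {0<..} t \<partial>lborel) \<partial>lborel)"
  proof (rule nn_integral_cong)
    fix t :: real
    have [measurable]: "W t \<in> borel_measurable borel" unfolding W_def by measurable
    show "(\<integral>\<^sup>+\<theta>. F t (t * cos \<theta>) * ennreal (sin \<theta> powr (2 * \<alpha>)) * indicator {0..pi} \<theta> \<partial>lborel)
            * ennreal (t powr (2 * \<alpha> + 1)) * indicator {0<..} t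
        = (\<integral>\<^sup>+u. W t u * indicator {-t..t} u * indicator {0<..} t \<partial>lborel)"
      by (cases "0 < t") (simp_all add: angular)
  qed
  also have "\<dots> = (\<integral>\<^sup>+u. (\<integral>\<^sup>+t. W t u * indicator {-t..t} u * indicator {0<..} t \<partial>lborel) \<partial>lborel)"
  proof (rule lborel_pair.Fubini')
    have "(\<lambda>(u, t). W t u * (if - t \<le> u \<and> u \<le> t then 1 else 0) * indicator {0<..} t) \<in> borel_measurable (lborel \<Otimes>\<^sub>M lborel)"
      unfolding W_def case_prod_beta' by measurable
    then show "(\<lambda>(u, t). W t u * indicator {-t..t} u * indicator {0<..} t) \<in> borel_measurable (lborel \<Otimes>\<^sub>M lborel)"
      by (simp add: indicator_def of_bool_def)
  qed
  also have "\<dots> = (\<integral>\<^sup>+u. (\<integral>\<^sup>+q. F (sqrt (q + u\<^sup>2)) u * ennreal (q powr (\<alpha> - 1/2) / 2) * indicator {0<..} q \<partial>lborel) \<partial>lborel)"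
    by (simp only: radial)
  finally show ?thesis .
qed

definition sin_powr_integral :: "real \<Rightarrow> ennreal" where
  "sin_powr_integral \<alpha> = (\<integral>\<^sup>+\<theta>. ennreal (sin \<theta> powr (2 * \<alpha>)) * indicator {0..pi} \<theta> \<partial>lborel)"

lemma nn_integral_radial_half_plane:
  fixes v :: "real \<Rightarrow> ennreal"
  assumes [measurable]: "v \<in> borel_measurable borel"
  shows "(\<integral>\<^sup>+u. (\<integral>\<^sup>+q. v (sqrt (q + u\<^sup>2)) * ennreal (q powr (\<alpha> - 1/2) / 2) * indicator {0<..} q \<partial>lborel) \<partial>lborel)
    = sin_powr_integral \<alpha> * (\<integral>\<^sup>+t. v t * ennreal (t powr (2 * \<alpha> + 1)) * indicator {0<..} t \<partial>lborel)"
proof -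
  have "(\<integral>\<^sup>+u. (\<integral>\<^sup>+q. v (sqrt (q + u\<^sup>2)) * ennreal (q powr (\<alpha> - 1/2) / 2) * indicator {0<..} q \<partial>lborel) \<partial>lborel)
    = (\<integral>\<^sup>+t. (\<integral>\<^sup>+\<theta>. v t * ennreal (sin \<theta> powr (2 * \<alpha>)) * indicator {0..pi} \<theta> \<partial>lborel)
            * ennreal (t powr (2 * \<alpha> + 1)) * indicator {0<..} t \<partial>lborel)"
    by (rule nn_integral_polar_half_plane[where F="\<lambda>t u. v t", symmetric]) measurable
  also have "\<dots> = (\<integral>\<^sup>+t. sin_powr_integral \<alpha> * (v t * ennreal (t powr (2 * \<alpha> + 1)) * indicator {0<..} t) \<partial>lborel)"
    by (intro nn_integral_cong) (simp add: mult.assoc nn_integral_cmult sin_powr_integral_def mult_ac)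
  also have "\<dots> = sin_powr_integral \<alpha> * (\<integral>\<^sup>+t. v t * ennreal (t powr (2 * \<alpha> + 1)) * indicator {0<..} t \<partial>lborel)"
    by (rule nn_integral_cmult) measurable
  finally show ?thesis .
qed

text \<open>
  In the coordinates \<open>(u, q)\<close> one has \<open>s\<^sup>2 + t\<^sup>2 + 2 s t cos \<theta> = q + (u + s)\<^sup>2\<close>, so the parameter \<open>s\<close>
  is removed by a translation of \<open>u\<close>.
\<close>
lemma nn_integral_bessel_translation:
  fixes v :: "real \<Rightarrow> ennreal"
  assumes [measurable]: "v \<in> borel_measurable borel"
  shows "(\<integral>\<^sup>+t. (\<integral>\<^sup>+\<theta>. v (sqrt (s\<^sup>2 + t\<^sup>2 + 2 * s * t * cos \<theta>)) * ennreal (sin \<theta> powr (2 * \<alpha>)) * indicator {0..pi} \<theta> \<partial>lborel)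
            * ennreal (t powr (2 * \<alpha> + 1)) * indicator {0<..} t \<partial>lborel)
    = sin_powr_integral \<alpha> * (\<integral>\<^sup>+t. v t * ennreal (t powr (2 * \<alpha> + 1)) * indicator {0<..} t \<partial>lborel)"
    (is "?L = _")
proof -
  define R where "R u = (\<integral>\<^sup>+q. v (sqrt (q + u\<^sup>2)) * ennreal (q powr (\<alpha> - 1/2) / 2) * indicator {0<..} q \<partial>lborel)" for u
  have [measurable]: "R \<in> borel_measurable borel"
    unfolding R_def by measurable
  have "?L = (\<integral>\<^sup>+u. (\<integral>\<^sup>+q. v (sqrt (s\<^sup>2 + (sqrt (q + u\<^sup>2))\<^sup>2 + 2 * s * u))
      * ennreal (q powr (\<alpha> - 1/2) / 2) * indicator {0<..} q \<partial>lborel) \<partial>lborel)"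
    using nn_integral_polar_half_plane[where F="\<lambda>t u. v (sqrt (s\<^sup>2 + t\<^sup>2 + 2 * s * u))" and \<alpha>=\<alpha>]
    by (simp add: mult.assoc)
  also have "\<dots> = (\<integral>\<^sup>+u. R (s + 1 * u) \<partial>lborel)"
    unfolding R_def
  proof (intro nn_integral_cong)
    fix u q :: real
    have eq: "s\<^sup>2 + (sqrt (q + u\<^sup>2))\<^sup>2 + 2 * s * u = q + (s + 1 * u)\<^sup>2" if "0 < q"
      using that by (simp add: power2_sum add_pos_nonneg less_imp_le)
    show "v (sqrt (s\<^sup>2 + (sqrt (q + u\<^sup>2))\<^sup>2 + 2 * s * u)) * ennreal (q powr (\<alpha> - 1/2) / 2) * indicator {0<..} q
        = v (sqrt (q + (s + 1 * u)\<^sup>2)) * ennreal (q powr (\<alpha> - 1/2) / 2) * indicator {0<..} q"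
    proof (cases "0 < q")
      case True
      show ?thesis unfolding eq[OF True] ..
    qed simp
  qed
  also have "\<dots> = (\<integral>\<^sup>+u. R u \<partial>lborel)"
    using nn_integral_real_affine[of R 1 s] by simp
  also have "\<dots> = sin_powr_integral \<alpha> * (\<integral>\<^sup>+t. v t * ennreal (t powr (2 * \<alpha> + 1)) * indicator {0<..} t \<partial>lborel)"
    unfolding R_def by (rule nn_integral_radial_half_plane) measurable
  finally show ?thesis .
qed

lemma nn_integral_powr_unit_interval:
  assumes "- 1 < a"
  shows "(\<integral>\<^sup>+t. ennreal (t powr a) * indicator {0..1} t \<partial>lborel) = ennreal (1 / (a + 1))"
proof -
  have "(\<integral>\<^sup>+t. ennreal (t powr a) * indicator {0..1} t \<partial>lborel) = ennreal (1 powr (a + 1) / (a + 1))"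
    using has_integral_powr_from_0[OF assms, of 1] by (intro nn_integral_has_integral_lebesgue') auto
  then show ?thesis by simp
qed

text \<open>
  Integrating over the upper half of the unit disc, the angular integral appears as a factor on one
  side, and the other side is at most \<open>2 \<integral>\<^sub>0\<^sup>1 q\<^bsup>\<alpha>-1/2\<^esup> dq\<close>, which is finite for \<open>\<alpha> > -1/2\<close>.
\<close>
lemma sin_powr_integral_finite:
  assumes "- 1 / 2 < \<alpha>"
  shows "sin_powr_integral \<alpha> < \<infinity>"
proof -
  let ?v = "indicator {..1} :: real \<Rightarrow> ennreal"
  have "sin_powr_integral \<alpha> * ennreal (1 / (2 * \<alpha> + 1 + 1))
      = sin_powr_integral \<alpha> * (\<integral>\<^sup>+t. ?v t * ennreal (t powr (2 * \<alpha> + 1)) * indicator {0<..} t \<partial>lborel)"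
  proof -
    have "ennreal (t powr (2 * \<alpha> + 1)) * indicator {0..1} t
        = ?v t * ennreal (t powr (2 * \<alpha> + 1)) * indicator {0<..} t" for t
      by (cases "t = 0") (auto simp: indicator_def)
    then show ?thesis
      using assms nn_integral_powr_unit_interval[of "2 * \<alpha> + 1"] by simp
  qed
  also have "\<dots> = (\<integral>\<^sup>+u. (\<integral>\<^sup>+q. ?v (sqrt (q + u\<^sup>2)) * ennreal (q powr (\<alpha> - 1/2) / 2) * indicator {0<..} q \<partial>lborel) \<partial>lborel)"
    by (rule nn_integral_radial_half_plane[symmetric]) measurable
  also have "\<dots> \<le> (\<integral>\<^sup>+u. (\<integral>\<^sup>+q. ennreal (q powr (\<alpha> - 1/2)) * indicator {0..1} q \<partial>lborel) * indicator {-1..1::real} u \<partial>lborel)"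
  proof (intro nn_integral_mono)
    fix u :: real
    have "(\<integral>\<^sup>+q. ?v (sqrt (q + u\<^sup>2)) * ennreal (q powr (\<alpha> - 1/2) / 2) * indicator {0<..} q \<partial>lborel)
        \<le> (\<integral>\<^sup>+q. ennreal (q powr (\<alpha> - 1/2)) * indicator {0..1} q * indicator {-1..1::real} u \<partial>lborel)"
    proof (intro nn_integral_mono)
      fix q :: real
      have "q \<le> 1 \<and> -1 \<le> u \<and> u \<le> 1" if "sqrt (q + u\<^sup>2) \<le> 1" "0 < q"
      proof -
        have "q + u\<^sup>2 \<le> 1" using that by simp
        then have "q \<le> 1" "u\<^sup>2 \<le> 1" using \<open>0 < q\<close> zero_le_power2[of u] by linarith+
        then show ?thesis using abs_le_square_iff[of u 1] by auto
      qed
      moreover have "ennreal (q powr (\<alpha> - 1/2) / 2) \<le> ennreal (q powr (\<alpha> - 1/2))"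
        by (intro ennreal_leI) simp
      ultimately show "?v (sqrt (q + u\<^sup>2)) * ennreal (q powr (\<alpha> - 1/2) / 2) * indicator {0<..} q
          \<le> ennreal (q powr (\<alpha> - 1/2)) * indicator {0..1} q * indicator {-1..1::real} u"
        by (auto simp: indicator_def)
    qed
    also have "\<dots> = (\<integral>\<^sup>+q. ennreal (q powr (\<alpha> - 1/2)) * indicator {0..1} q \<partial>lborel) * indicator {-1..1::real} u"
      by (rule nn_integral_multc) measurable
    finally show "(\<integral>\<^sup>+q. ?v (sqrt (q + u\<^sup>2)) * ennreal (q powr (\<alpha> - 1/2) / 2) * indicator {0<..} q \<partial>lborel)
        \<le> (\<integral>\<^sup>+q. ennreal (q powr (\<alpha> - 1/2)) * indicator {0..1} q \<partial>lborel) * indicator {-1..1::real} u" .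
  qed
  also have "\<dots> = ennreal (1 / (\<alpha> - 1/2 + 1)) * emeasure lborel {-1..1::real}"
    using assms by (subst nn_integral_powr_unit_interval) (simp_all add: nn_integral_cmult)
  also have "\<dots> < \<infinity>" by (simp add: ennreal_mult_less_top)
  finally have "sin_powr_integral \<alpha> * ennreal (1 / (2 * \<alpha> + 1 + 1)) < \<infinity>" .
  then show ?thesis using assms by (auto simp: ennreal_mult_less_top)
qed

section \<open>The Weinstein measure, dilations and translations\<close>

lemma borel_measurable_fst_prod [measurable]:
  "fst \<in> borel_measurable (borel :: ('a::second_countable_topology \<times> 'b::second_countable_topology) measure)"
  by (intro borel_measurable_continuous_onI continuous_intros)

lemma borel_measurable_snd_prod [measurable]:
  "snd \<in> borel_measurable (borel :: ('a::second_countable_topology \<times> 'b::second_countable_topology) measure)"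
  by (intro borel_measurable_continuous_onI continuous_intros)

lemma upper_half_space_borel[measurable]: "(upper_half_space :: ((real ^ 'd) \<times> real) set) \<in> sets borel"
  unfolding upper_half_space_def by measurable

lemma sets_weinstein_measure:
  "sets (weinstein_measure \<alpha> :: ((real ^ 'd) \<times> real) measure) = sets (restrict_space borel upper_half_space)"
  unfolding weinstein_measure_def by (simp add: sets_restrict_space_cong[OF sets_lborel])

lemma space_weinstein_measure[simp]: "space (weinstein_measure \<alpha>) = upper_half_space"
  unfolding weinstein_measure_def by (simp add: space_restrict_space)

lemma measurable_weinstein_measure_borel:
  "f \<in> measurable borel N \<Longrightarrow> f \<in> measurable (weinstein_measure \<alpha>) N"
  using measurable_cong_sets[OF sets_weinstein_measure refl] measurable_restrict_space1 by blast

definition weinstein_density :: "real \<Rightarrow> nat \<Rightarrow> real \<Rightarrow> real" where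
  "weinstein_density \<alpha> d t = t powr (2 * \<alpha> + 1) / ((2 * pi) ^ d * 2 powr (2 * \<alpha>) * (Gamma (\<alpha> + 1))\<^sup>2)"

lemma weinstein_density_nonneg: "0 \<le> weinstein_density \<alpha> d t"
  by (simp add: weinstein_density_def)

lemma weinstein_density_measurable[measurable]: "weinstein_density \<alpha> d \<in> borel_measurable borel"
  unfolding weinstein_density_def by measurable

lemma nn_integral_weinstein_measure:
  fixes u :: "(real ^ 'd) \<times> real \<Rightarrow> ennreal"
  assumes [measurable]: "u \<in> borel_measurable borel"
  shows "(\<integral>\<^sup>+x. u x \<partial>weinstein_measure \<alpha>)
    = (\<integral>\<^sup>+x. u x * ennreal (weinstein_density \<alpha> CARD('d) (snd x)) * indicator {0<..} (snd x) \<partial>lborel)"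
proof -
  have [measurable]: "u \<in> borel_measurable (restrict_space lborel upper_half_space)"
    "(\<lambda>x. weinstein_density \<alpha> CARD('d) (snd x)) \<in> borel_measurable (restrict_space lborel (upper_half_space :: ((real ^ 'd) \<times> real) set))"
    by (auto intro!: measurable_restrict_space1)
  have "(\<integral>\<^sup>+x. u x \<partial>weinstein_measure \<alpha>)
      = (\<integral>\<^sup>+x. ennreal (weinstein_density \<alpha> CARD('d) (snd x)) * u x \<partial>restrict_space lborel upper_half_space)"
    unfolding weinstein_measure_def weinstein_density_def[symmetric] by (subst nn_integral_density) measurable
  also have "\<dots> = (\<integral>\<^sup>+x. ennreal (weinstein_density \<alpha> CARD('d) (snd x)) * u x * indicator upper_half_space x \<partial>lborel)"
    by (rule nn_integral_restrict_space) simp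
  also have "\<dots> = (\<integral>\<^sup>+x. u x * ennreal (weinstein_density \<alpha> CARD('d) (snd x)) * indicator {0<..} (snd x) \<partial>lborel)"
    by (intro nn_integral_cong) (auto simp: upper_half_space_def indicator_def mult.commute)
  finally show ?thesis .
qed

lemma nn_integral_weinstein_iterated:
  fixes u :: "(real ^ 'd) \<times> real \<Rightarrow> ennreal"
  assumes [measurable]: "u \<in> borel_measurable borel"
  shows "(\<integral>\<^sup>+x. u x \<partial>weinstein_measure \<alpha>)
    = (\<integral>\<^sup>+x'. (\<integral>\<^sup>+t. u (x', t) * ennreal (weinstein_density \<alpha> CARD('d) t) * indicator {0<..} t \<partial>lborel) \<partial>lborel)"
proof -
  have "(\<integral>\<^sup>+x. u x \<partial>weinstein_measure \<alpha>)
    = (\<integral>\<^sup>+x. u x * ennreal (weinstein_density \<alpha> CARD('d) (snd x)) * indicator {0<..} (snd x) \<partial>(lborel \<Otimes>\<^sub>M lborel))"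
    unfolding lborel_prod by (rule nn_integral_weinstein_measure[OF assms])
  also have "\<dots> = (\<integral>\<^sup>+x'. (\<integral>\<^sup>+t. u (x', t) * ennreal (weinstein_density \<alpha> CARD('d) t) * indicator {0<..} t \<partial>lborel) \<partial>lborel)"
  proof (subst lborel.nn_integral_fst[symmetric])
    show "(\<lambda>x. u x * ennreal (weinstein_density \<alpha> CARD('d) (snd x)) * indicator {0<..} (snd x))
        \<in> borel_measurable (lborel \<Otimes>\<^sub>M lborel)"
      unfolding lborel_prod by measurable
  qed simp
  finally show ?thesis .
qed

lemma sigma_finite_weinstein_measure: "sigma_finite_measure (weinstein_measure \<alpha> :: ((real ^ 'd) \<times> real) measure)"
proof -
  have "sigma_finite_measure (restrict_space lborel (upper_half_space :: ((real ^ 'd) \<times> real) set))"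
    by (rule sigma_finite_measure_restrict_space) (auto intro: lborel.sigma_finite_measure_axioms)
  moreover have "(\<lambda>x::(real ^ 'd) \<times> real. ennreal (weinstein_density \<alpha> CARD('d) (snd x)))
      \<in> borel_measurable (restrict_space lborel upper_half_space)"
    by (intro measurable_restrict_space1) measurable
  ultimately show ?thesis
    unfolding weinstein_measure_def weinstein_density_def[symmetric]
    by (subst sigma_finite_measure.sigma_finite_iff_density_finite) auto
qed

lemma sets_weinstein_measure_X:
  "sets (weinstein_measure_X \<alpha> :: (real \<times> ((real ^ 'd) \<times> real)) measure)
     = sets (restrict_space borel {0::real<..} \<Otimes>\<^sub>M restrict_space borel upper_half_space)"
  unfolding weinstein_measure_X_def
  by (simp only: sets_density)
    (intro sets_pair_measure_cong sets_restrict_space_cong sets_weinstein_measure sets_lborel)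

lemma space_weinstein_measure_X: "space (weinstein_measure_X \<alpha>) = {0<..} \<times> upper_half_space"
  unfolding weinstein_measure_X_def by (simp add: space_pair_measure space_restrict_space)

lemma sigma_finite_weinstein_measure_X:
  "sigma_finite_measure (weinstein_measure_X \<alpha> :: (real \<times> ((real ^ 'd) \<times> real)) measure)"
proof -
  have "sigma_finite_measure (restrict_space lborel {0::real<..} \<Otimes>\<^sub>M (weinstein_measure \<alpha> :: ((real ^ 'd) \<times> real) measure))"
    by (intro sigma_finite_pair_measure sigma_finite_weinstein_measure sigma_finite_measure_restrict_space)
      (auto intro: lborel.sigma_finite_measure_axioms)
  moreover have "(\<lambda>(a, x :: (real ^ 'd) \<times> real). ennreal (1 / a powr (2 * \<alpha> + real CARD('d) + 3)))
      \<in> borel_measurable (restrict_space lborel {0::real<..} \<Otimes>\<^sub>M weinstein_measure \<alpha>)"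
  proof -
    have "(\<lambda>a. ennreal (1 / a powr (2 * \<alpha> + real CARD('d) + 3))) \<in> borel_measurable (restrict_space lborel {0::real<..})"
      by (intro measurable_restrict_space1) measurable
    from measurable_compose[OF measurable_fst this] show ?thesis by (simp add: case_prod_beta')
  qed
  ultimately show ?thesis
    unfolding weinstein_measure_X_def
    by (subst sigma_finite_measure.sigma_finite_iff_density_finite) auto
qed

lemma countably_generated_weinstein_measure:
  "countably_generated (weinstein_measure \<alpha> :: ((real ^ 'd) \<times> real) measure)"
  unfolding countably_generated_sets_cong[OF sets_weinstein_measure]
  by (intro countably_generated_restrict_space countably_generated_borel)

lemma countably_generated_weinstein_measure_X:
  "countably_generated (weinstein_measure_X \<alpha> :: (real \<times> ((real ^ 'd) \<times> real)) measure)"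
  unfolding countably_generated_sets_cong[OF sets_weinstein_measure_X]
  by (intro countably_generated_pair countably_generated_restrict_space countably_generated_borel)

text \<open>
  The homogeneous dimension \<open>2\<alpha> + d + 2\<close> is the sum of the topological dimension \<open>d + 1\<close> and the
  degree \<open>2\<alpha> + 1\<close> of the density.
\<close>
lemma nn_integral_weinstein_dilation:
  fixes u :: "(real ^ 'd) \<times> real \<Rightarrow> ennreal"
  assumes [measurable]: "u \<in> borel_measurable borel" and a: "0 < a"
  shows "(\<integral>\<^sup>+x. u (x /\<^sub>R a) \<partial>weinstein_measure \<alpha>)
    = ennreal (a powr (2 * \<alpha> + real CARD('d) + 2)) * (\<integral>\<^sup>+x. u x \<partial>weinstein_measure \<alpha>)"
proof -
  let ?w = "weinstein_density \<alpha> CARD('d)"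
  let ?g = "\<lambda>x :: (real ^ 'd) \<times> real. u (x /\<^sub>R a) * ennreal (?w (snd x)) * indicator {0<..} (snd x)"
  have w_scale: "?w (a * t) = a powr (2 * \<alpha> + 1) * ?w t" if "0 < t" for t
    using that a by (simp add: weinstein_density_def powr_mult)
  have "(\<integral>\<^sup>+x. u (x /\<^sub>R a) \<partial>weinstein_measure \<alpha>) = (\<integral>\<^sup>+x. ?g x \<partial>lborel)"
    by (rule nn_integral_weinstein_measure) measurable
  also have "\<dots> = (\<integral>\<^sup>+x. ennreal (a ^ (CARD('d) + 1)) * ?g (a *\<^sub>R x) \<partial>lborel)"
    using a by (subst lborel_affine[of a 0]) (simp_all add: nn_integral_density nn_integral_distr
      del: of_nat_Suc)
  also have "\<dots> = (\<integral>\<^sup>+x. ennreal (a powr (2 * \<alpha> + real CARD('d) + 2))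
      * (u x * ennreal (?w (snd x)) * indicator {0<..} (snd x)) \<partial>lborel)"
  proof (rule nn_integral_cong)
    fix x :: "(real ^ 'd) \<times> real"
    show "ennreal (a ^ (CARD('d) + 1)) * ?g (a *\<^sub>R x) = ennreal (a powr (2 * \<alpha> + real CARD('d) + 2))
      * (u x * ennreal (?w (snd x)) * indicator {0<..} (snd x))"
    proof (cases "0 < snd x")
      case True
      have "a ^ (CARD('d) + 1) * ?w (a * snd x) = a powr real (CARD('d) + 1) * a powr (2 * \<alpha> + 1) * ?w (snd x)"
        using a by (simp only: w_scale[OF True] powr_realpow mult.assoc)
      also have "\<dots> = a powr (2 * \<alpha> + real CARD('d) + 2) * ?w (snd x)"
        by (simp only: powr_add[symmetric]) (simp add: add_ac)
      finally have "ennreal (a ^ (CARD('d) + 1)) * ennreal (?w (a * snd x))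
          = ennreal (a powr (2 * \<alpha> + real CARD('d) + 2)) * ennreal (?w (snd x))"
        using a by (simp only: ennreal_mult[symmetric] weinstein_density_nonneg zero_le_power powr_ge_zero less_imp_le)
      then have "u x * (ennreal (a ^ (CARD('d) + 1)) * ennreal (?w (a * snd x)))
          = u x * (ennreal (a powr (2 * \<alpha> + real CARD('d) + 2)) * ennreal (?w (snd x)))" by simp
      then show ?thesis using True a by (simp add: mult_ac)
    next
      case False
      then show ?thesis using a by (simp add: zero_less_mult_iff)
    qed
  qed
  also have "\<dots> = ennreal (a powr (2 * \<alpha> + real CARD('d) + 2)) * (\<integral>\<^sup>+x. u x \<partial>weinstein_measure \<alpha>)"
    unfolding nn_integral_weinstein_measure[OF assms(1)] by (rule nn_integral_cmult) measurable
  finally show ?thesis .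
qed

definition translate_arg :: "(real ^ 'd) \<times> real \<Rightarrow> (real ^ 'd) \<times> real \<Rightarrow> real \<Rightarrow> (real ^ 'd) \<times> real" where
  "translate_arg x y \<theta> =
     (fst x + fst y, sqrt ((snd x)\<^sup>2 + (snd y)\<^sup>2 + 2 * snd x * snd y * cos \<theta>))"

lemma translate_arg_measurable[measurable (raw)]:
  assumes "f \<in> borel_measurable M" "g \<in> borel_measurable M" "h \<in> borel_measurable M"
  shows "(\<lambda>w. translate_arg (f w) (g w) (h w)) \<in> borel_measurable M"
proof -
  note assms[measurable]
  have "(\<lambda>w. translate_arg (f w) (g w) (h w)) \<in> measurable M (borel \<Otimes>\<^sub>M borel)"
    unfolding translate_arg_def by measurable
  then show ?thesis by (simp add: borel_prod)
qed

text \<open>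
  For \<open>u = \<bar>\<phi>\<bar>\<close> this gives the \<open>L\<^sup>1\<close> bound of the generalized translation, and for the indicator of a
  null set it shows that almost every integral in the definition of the translate avoids that
  null set up to a null set of angles, which gives the \<open>L\<^sup>\<infinity>\<close> bound.
\<close>
lemma nn_integral_weinstein_translation:
  fixes u :: "(real ^ 'd) \<times> real \<Rightarrow> ennreal"
  assumes [measurable]: "u \<in> borel_measurable borel"
  shows "(\<integral>\<^sup>+y. (\<integral>\<^sup>+\<theta>. u (translate_arg x y \<theta>) * ennreal (sin \<theta> powr (2 * \<alpha>)) * indicator {0..pi} \<theta> \<partial>lborel) \<partial>weinstein_measure \<alpha>)
    = sin_powr_integral \<alpha> * (\<integral>\<^sup>+y. u y \<partial>weinstein_measure \<alpha>)"
proof -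
  define C where "C = (2 * pi) ^ CARD('d) * 2 powr (2 * \<alpha>) * (Gamma (\<alpha> + 1))\<^sup>2"
  have C: "0 \<le> C" by (simp add: C_def)
  have dens: "ennreal (weinstein_density \<alpha> CARD('d) t) = ennreal (t powr (2 * \<alpha> + 1)) * ennreal (1 / C)" for t
    unfolding weinstein_density_def C_def[symmetric] using C by (simp add: ennreal_mult[symmetric])
  have [measurable]: "(\<lambda>r. u (x', r)) \<in> borel_measurable borel" for x'
    by (rule measurable_compose[OF measurable_Pair1' assms[unfolded borel_prod[symmetric]]]) simp
  define G where "G x' = (\<integral>\<^sup>+r. u (x', r) * ennreal (weinstein_density \<alpha> CARD('d) r) * indicator {0<..} r \<partial>lborel)" for x'
  have [measurable]: "G \<in> borel_measurable borel"
    unfolding G_def using assms[unfolded borel_prod[symmetric], measurable] by measurable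
  have "(\<integral>\<^sup>+y. (\<integral>\<^sup>+\<theta>. u (translate_arg x y \<theta>) * ennreal (sin \<theta> powr (2 * \<alpha>)) * indicator {0..pi} \<theta> \<partial>lborel) \<partial>weinstein_measure \<alpha>)
    = (\<integral>\<^sup>+y'. (\<integral>\<^sup>+t. (\<integral>\<^sup>+\<theta>. u (translate_arg x (y', t) \<theta>) * ennreal (sin \<theta> powr (2 * \<alpha>)) * indicator {0..pi} \<theta> \<partial>lborel)
        * ennreal (weinstein_density \<alpha> CARD('d) t) * indicator {0<..} t \<partial>lborel) \<partial>lborel)"
    by (rule nn_integral_weinstein_iterated) measurable
  also have "\<dots> = (\<integral>\<^sup>+y'. sin_powr_integral \<alpha> * G (fst x + y') \<partial>lborel)"
  proof (rule nn_integral_cong)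
    fix y' :: "real ^ 'd"
    let ?v = "\<lambda>r. u (fst x + y', r) * ennreal (1 / C)"
    have "(\<integral>\<^sup>+t. (\<integral>\<^sup>+\<theta>. u (translate_arg x (y', t) \<theta>) * ennreal (sin \<theta> powr (2 * \<alpha>)) * indicator {0..pi} \<theta> \<partial>lborel)
        * ennreal (weinstein_density \<alpha> CARD('d) t) * indicator {0<..} t \<partial>lborel)
      = (\<integral>\<^sup>+t. (\<integral>\<^sup>+\<theta>. ?v (sqrt ((snd x)\<^sup>2 + t\<^sup>2 + 2 * snd x * t * cos \<theta>)) * ennreal (sin \<theta> powr (2 * \<alpha>)) * indicator {0..pi} \<theta> \<partial>lborel)
        * ennreal (t powr (2 * \<alpha> + 1)) * indicator {0<..} t \<partial>lborel)"
    proof (rule nn_integral_cong)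
      fix t :: real
      have "(\<integral>\<^sup>+\<theta>. ?v (sqrt ((snd x)\<^sup>2 + t\<^sup>2 + 2 * snd x * t * cos \<theta>)) * ennreal (sin \<theta> powr (2 * \<alpha>)) * indicator {0..pi} \<theta> \<partial>lborel)
        = (\<integral>\<^sup>+\<theta>. u (translate_arg x (y', t) \<theta>) * ennreal (sin \<theta> powr (2 * \<alpha>)) * indicator {0..pi} \<theta> * ennreal (1 / C) \<partial>lborel)"
        by (simp add: translate_arg_def mult_ac)
      also have "\<dots> = (\<integral>\<^sup>+\<theta>. u (translate_arg x (y', t) \<theta>) * ennreal (sin \<theta> powr (2 * \<alpha>)) * indicator {0..pi} \<theta> \<partial>lborel) * ennreal (1 / C)"
        by (rule nn_integral_multc) measurable
      finally show "(\<integral>\<^sup>+\<theta>. u (translate_arg x (y', t) \<theta>) * ennreal (sin \<theta> powr (2 * \<alpha>)) * indicator {0..pi} \<theta> \<partial>lborel)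
        * ennreal (weinstein_density \<alpha> CARD('d) t) * indicator {0<..} t
        = (\<integral>\<^sup>+\<theta>. ?v (sqrt ((snd x)\<^sup>2 + t\<^sup>2 + 2 * snd x * t * cos \<theta>)) * ennreal (sin \<theta> powr (2 * \<alpha>)) * indicator {0..pi} \<theta> \<partial>lborel)
        * ennreal (t powr (2 * \<alpha> + 1)) * indicator {0<..} t"
        by (simp only: dens mult_ac)
    qed
    also have "\<dots> = sin_powr_integral \<alpha> * (\<integral>\<^sup>+t. ?v t * ennreal (t powr (2 * \<alpha> + 1)) * indicator {0<..} t \<partial>lborel)"
      by (rule nn_integral_bessel_translation) measurable
    also have "\<dots> = sin_powr_integral \<alpha> * G (fst x + y')"
      unfolding G_def dens by (simp add: mult_ac)
    finally show "(\<integral>\<^sup>+t. (\<integral>\<^sup>+\<theta>. u (translate_arg x (y', t) \<theta>) * ennreal (sin \<theta> powr (2 * \<alpha>)) * indicator {0..pi} \<theta> \<partial>lborel)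
        * ennreal (weinstein_density \<alpha> CARD('d) t) * indicator {0<..} t \<partial>lborel) = sin_powr_integral \<alpha> * G (fst x + y')" .
  qed
  also have "\<dots> = sin_powr_integral \<alpha> * (\<integral>\<^sup>+y'. G (fst x + y') \<partial>lborel)"
    by (rule nn_integral_cmult) measurable
  also have "(\<integral>\<^sup>+y'. G (fst x + y') \<partial>lborel) = (\<integral>\<^sup>+y'. G y' \<partial>distr lborel borel ((+) (fst x)))"
    by (rule nn_integral_distr[symmetric]) measurable
  also have "\<dots> = (\<integral>\<^sup>+y'. G y' \<partial>lborel)"
    by (simp only: lborel_distr_plus)
  also have "\<dots> = (\<integral>\<^sup>+y. u y \<partial>weinstein_measure \<alpha>)"
    unfolding G_def by (rule nn_integral_weinstein_iterated[symmetric]) measurable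
  finally show ?thesis .
qed

section \<open>Bounds for the wavelets\<close>

text \<open>
  Without integrability the Bochner integral has the default value \<open>0\<close>, so the inequality persists;
  this covers the exceptional points at which a translate is not defined by a convergent integral.
\<close>
lemma norm_integral_le_nn_integral:
  "ennreal (norm (\<integral>x. f x \<partial>M)) \<le> (\<integral>\<^sup>+x. ennreal (norm (f x)) \<partial>M)"
  by (cases "integrable M f") (simp_all add: integral_norm_bound_ennreal not_integrable_integral_eq)

definition bessel_const :: "real \<Rightarrow> real" where
  "bessel_const \<alpha> = Gamma (\<alpha> + 1) / (sqrt pi * Gamma (\<alpha> + 1/2))"

lemma gen_translation_eq:
  "gen_translation \<alpha> x \<phi> y = bessel_const \<alpha> *\<^sub>R
     (\<integral>\<theta>. indicator {0<..<pi} \<theta> *\<^sub>R ((sin \<theta> powr (2 * \<alpha>)) *\<^sub>R \<phi> (translate_arg x y \<theta>)) \<partial>lborel)"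
  unfolding gen_translation_def bessel_const_def translate_arg_def interval_lebesgue_integral_def
    set_lebesgue_integral_def by (simp add: zero_ereal_def)

lemma norm_gen_translation_le:
  "ennreal (norm (gen_translation \<alpha> x \<phi> y)) \<le> ennreal \<bar>bessel_const \<alpha>\<bar> *
     (\<integral>\<^sup>+\<theta>. ennreal (norm (\<phi> (translate_arg x y \<theta>))) * ennreal (sin \<theta> powr (2 * \<alpha>)) * indicator {0..pi} \<theta> \<partial>lborel)"
proof -
  have "ennreal (norm (gen_translation \<alpha> x \<phi> y)) = ennreal \<bar>bessel_const \<alpha>\<bar> *
      ennreal (norm (\<integral>\<theta>. indicator {0<..<pi} \<theta> *\<^sub>R ((sin \<theta> powr (2 * \<alpha>)) *\<^sub>R \<phi> (translate_arg x y \<theta>)) \<partial>lborel))"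
    unfolding gen_translation_eq by (simp add: ennreal_mult)
  also have "\<dots> \<le> ennreal \<bar>bessel_const \<alpha>\<bar> *
      (\<integral>\<^sup>+\<theta>. ennreal (norm (indicator {0<..<pi} \<theta> *\<^sub>R ((sin \<theta> powr (2 * \<alpha>)) *\<^sub>R \<phi> (translate_arg x y \<theta>)))) \<partial>lborel)"
    by (intro mult_left_mono norm_integral_le_nn_integral) simp
  also have "\<dots> \<le> ennreal \<bar>bessel_const \<alpha>\<bar> *
      (\<integral>\<^sup>+\<theta>. ennreal (norm (\<phi> (translate_arg x y \<theta>))) * ennreal (sin \<theta> powr (2 * \<alpha>)) * indicator {0..pi} \<theta> \<partial>lborel)"
    by (intro mult_left_mono nn_integral_mono)
      (auto simp: indicator_def ennreal_mult[symmetric] mult.commute)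
  finally show ?thesis .
qed

text \<open>
  The squared last coordinate exceeds \<open>(x\<^bsub>d+1\<^esub> - y\<^bsub>d+1\<^esub>)\<^sup>2\<close> since \<open>cos \<theta> > -1\<close>.
\<close>
lemma translate_arg_in_half_space:
  assumes "x \<in> upper_half_space" "y \<in> upper_half_space" "\<theta> \<in> {0<..<pi}"
  shows "translate_arg x y \<theta> \<in> upper_half_space"
proof -
  have pos: "0 < snd x" "0 < snd y" using assms by (auto simp: upper_half_space_def)
  have "- 1 < cos \<theta>"
    using assms(3) cos_monotone_0_pi[of \<theta> pi] by simp
  then have "2 * (snd x * snd y) * (- 1) < 2 * (snd x * snd y) * cos \<theta>"
    using pos by (intro mult_strict_left_mono) auto
  moreover have "0 \<le> (snd x - snd y)\<^sup>2" by simp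
  ultimately have "0 < (snd x)\<^sup>2 + (snd y)\<^sup>2 + 2 * snd x * snd y * cos \<theta>"
    by (simp add: power2_diff algebra_simps)
  then show ?thesis by (simp add: upper_half_space_def translate_arg_def)
qed

text \<open>
  Windows are measurable only on the half-space, and the arguments of the translation lie in it
  only for \<open>0 < \<theta> < \<pi>\<close>.  Extending by zero gives Borel functions on the whole space, so that joint
  measurability in \<open>(a, x, y, \<theta>)\<close> follows by composition.
\<close>
definition zero_extension :: "((real ^ 'd) \<times> real \<Rightarrow> complex) \<Rightarrow> (real ^ 'd) \<times> real \<Rightarrow> complex" where
  "zero_extension \<phi> x = indicator upper_half_space x *\<^sub>R \<phi> x"

lemma zero_extension_measurable:
  assumes "\<phi> \<in> borel_measurable (weinstein_measure \<alpha>)"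
  shows "zero_extension \<phi> \<in> borel_measurable borel"
proof -
  have "\<phi> \<in> borel_measurable (restrict_space borel upper_half_space)"
    using assms measurable_cong_sets[OF sets_weinstein_measure refl] by blast
  then show ?thesis
    unfolding zero_extension_def by (subst (asm) borel_measurable_restrict_space_iff) auto
qed

lemma wavelet_zero_extension:
  fixes x y :: "(real ^ 'd) \<times> real"
  assumes "0 < a" "x \<in> upper_half_space" "y \<in> upper_half_space"
  shows "wavelet \<alpha> \<phi> a x y = wavelet \<alpha> (zero_extension \<phi>) a x y"
proof -
  have "dilation \<alpha> a (zero_extension \<phi>) z = dilation \<alpha> a \<phi> z" if "z \<in> upper_half_space" for z :: "(real ^ 'd) \<times> real"
    using that assms(1) by (simp add: dilation_def zero_extension_def upper_half_space_def)
  then have eq: "indicator {0<..<pi} \<theta> *\<^sub>R (c *\<^sub>R dilation \<alpha> a \<phi> (translate_arg x y \<theta>))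
      = indicator {0<..<pi} \<theta> *\<^sub>R (c *\<^sub>R dilation \<alpha> a (zero_extension \<phi>) (translate_arg x y \<theta>))" for c \<theta>
    using translate_arg_in_half_space[OF assms(2,3)] by (cases "\<theta> \<in> {0<..<pi}") auto
  show ?thesis
    unfolding wavelet_def gen_translation_eq eq ..
qed

lemma wavelet_borel_measurable:
  fixes \<phi> :: "(real ^ 'd) \<times> real \<Rightarrow> complex"
  assumes [measurable]: "\<phi> \<in> borel_measurable borel"
    and [measurable]: "a \<in> borel_measurable M" "x \<in> borel_measurable M" "y \<in> borel_measurable M"
  shows "(\<lambda>w. wavelet \<alpha> \<phi> (a w) (x w) (y w)) \<in> borel_measurable M"
proof -
  have "(\<lambda>(w, \<theta>). indicator {0<..<pi} \<theta> *\<^sub>R ((sin \<theta> powr (2 * \<alpha>)) *\<^sub>R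
      dilation \<alpha> (a w) \<phi> (translate_arg (x w) (y w) \<theta>))) \<in> borel_measurable (M \<Otimes>\<^sub>M lborel)"
    unfolding dilation_def case_prod_beta' by measurable
  from lborel.borel_measurable_lebesgue_integral[OF this]
  have [measurable]: "(\<lambda>w. \<integral>\<theta>. indicator {0<..<pi} \<theta> *\<^sub>R ((sin \<theta> powr (2 * \<alpha>)) *\<^sub>R
      dilation \<alpha> (a w) \<phi> (translate_arg (x w) (y w) \<theta>)) \<partial>lborel) \<in> borel_measurable M" .
  show ?thesis
    unfolding wavelet_def gen_translation_eq by measurable
qed

lemma wavelet_measurable:
  fixes \<phi> :: "(real ^ 'd) \<times> real \<Rightarrow> complex"
  assumes "\<phi> \<in> borel_measurable (weinstein_measure \<alpha>)"
  shows "(\<lambda>(w, y). wavelet \<alpha> \<phi> (fst w) (snd w) y)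
    \<in> borel_measurable (weinstein_measure_X \<alpha> \<Otimes>\<^sub>M weinstein_measure \<alpha>)"
    (is "_ \<in> borel_measurable ?P")
proof -
  have id_half: "(\<lambda>x. x) \<in> borel_measurable (weinstein_measure \<alpha> :: ((real ^ 'd) \<times> real) measure)"
    by (rule measurable_weinstein_measure_borel) simp
  have fst_X: "fst \<in> borel_measurable (weinstein_measure_X \<alpha> :: (real \<times> ((real ^ 'd) \<times> real)) measure)"
    unfolding measurable_cong_sets[OF sets_weinstein_measure_X refl]
    by (rule measurable_compose[OF measurable_fst measurable_restrict_space1]) simp
  have snd_X: "snd \<in> borel_measurable (weinstein_measure_X \<alpha> :: (real \<times> ((real ^ 'd) \<times> real)) measure)"
    unfolding measurable_cong_sets[OF sets_weinstein_measure_X refl]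
    by (rule measurable_compose[OF measurable_snd measurable_restrict_space1]) simp
  have "(\<lambda>p. wavelet \<alpha> (zero_extension \<phi>) (fst (fst p)) (snd (fst p)) (snd p)) \<in> borel_measurable ?P"
    by (rule wavelet_borel_measurable[OF zero_extension_measurable[OF assms]
          measurable_compose[OF measurable_fst fst_X] measurable_compose[OF measurable_fst snd_X]
          measurable_compose[OF measurable_snd id_half]])
  then show ?thesis
    by (subst measurable_cong[where g="\<lambda>p. wavelet \<alpha> (zero_extension \<phi>) (fst (fst p)) (snd (fst p)) (snd p)"])
      (auto simp: space_pair_measure space_weinstein_measure_X intro!: wavelet_zero_extension)
qed

text \<open>
  The exponent \<open>\<alpha> + 1 + d/2\<close> is half of the homogeneous dimension, called \<open>h\<close> in the proof.
  The normalization \<open>a\<^sup>h\<close> of the wavelet times the factor \<open>a\<^bsup>-2h\<^esup>\<close> of the dilation leaves \<open>a\<^bsup>-h\<^esup>\<close>, which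
  is the size of the supremum; the \<open>L\<^sup>1\<close> norm gains the factor \<open>a\<^bsup>2h\<^esup>\<close> by scaling.
\<close>
lemma wavelet_bounds:
  fixes \<phi> :: "(real ^ 'd) \<times> real \<Rightarrow> complex"
  assumes \<alpha>: "\<alpha> > - 1 / 2"
    and \<phi>: "\<phi> \<in> Lp_space (weinstein_measure \<alpha>) 1 \<inter> Lp_space (weinstein_measure \<alpha>) \<infinity>"
  obtains B where "0 \<le> B"
    "\<And>a x. 0 < a \<Longrightarrow> x \<in> upper_half_space \<Longrightarrow>
      (\<integral>\<^sup>+y. ennreal (norm (wavelet \<alpha> \<phi> a x y)) \<partial>weinstein_measure \<alpha>) \<le> ennreal (B * a powr (\<alpha> + 1 + real CARD('d) / 2))"
    "\<And>a x. 0 < a \<Longrightarrow> x \<in> upper_half_space \<Longrightarrow>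
      AE y in weinstein_measure \<alpha>. norm (wavelet \<alpha> \<phi> a x y) \<le> B / a powr (\<alpha> + 1 + real CARD('d) / 2)"
proof -
  let ?W = "weinstein_measure \<alpha> :: ((real ^ 'd) \<times> real) measure"
  define h where "h = \<alpha> + 1 + real CARD('d) / 2"
  define u where "u = zero_extension \<phi>"
  have \<phi>_meas: "\<phi> \<in> borel_measurable ?W" using \<phi> Lp_space_measurable by blast
  then have [measurable]: "u \<in> borel_measurable borel" unfolding u_def by (rule zero_extension_measurable)
  have u_W: "u \<in> borel_measurable ?W" by (rule measurable_weinstein_measure_borel) measurable
  have u_eq: "u y = \<phi> y" if "y \<in> space ?W" for y using that by (simp add: u_def zero_extension_def)
  define I where "I = enn2real (sin_powr_integral \<alpha>)"
  have I: "sin_powr_integral \<alpha> = ennreal I" "0 \<le> I"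
    using sin_powr_integral_finite[OF \<alpha>] by (auto simp: I_def less_top)
  define k where "k = \<bar>bessel_const \<alpha>\<bar>"
  have k: "0 \<le> k" by (simp add: k_def)
  define b1 where "b1 = (\<integral>y. norm (\<phi> y) \<partial>?W)"
  have \<phi>_int: "integrable ?W (\<lambda>y. norm (\<phi> y))"
    using Lp_space_finite_integrable[of \<phi> ?W 1] \<phi> by simp
  have b1: "0 \<le> b1" "(\<integral>\<^sup>+y. ennreal (norm (u y)) \<partial>?W) = ennreal b1"
  proof -
    have "(\<integral>\<^sup>+y. ennreal (norm (u y)) \<partial>?W) = (\<integral>\<^sup>+y. ennreal (norm (\<phi> y)) \<partial>?W)"
      by (intro nn_integral_cong) (simp add: u_eq)
    also have "\<dots> = ennreal b1" unfolding b1_def using \<phi>_int by (intro nn_integral_eq_integral) auto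
    finally show "(\<integral>\<^sup>+y. ennreal (norm (u y)) \<partial>?W) = ennreal b1" .
  qed (simp add: b1_def)
  define b where "b = Lp_norm ?W \<infinity> \<phi>"
  have b: "0 \<le> b" "AE y in ?W. norm (u y) \<le> b"
  proof -
    show "AE y in ?W. norm (u y) \<le> b"
      using Lp_space_infinity_AE[of \<phi> ?W] \<phi> AE_space unfolding b_def by (auto simp: u_eq)
  qed (simp add: b_def Lp_norm_nonneg)
  define T where "T a x y = (\<integral>\<^sup>+\<theta>. ennreal (norm (u (translate_arg x y \<theta> /\<^sub>R a))) * ennreal (sin \<theta> powr (2 * \<alpha>)) * indicator {0..pi} \<theta> \<partial>lborel)" for a x y
  have wavelet_le: "ennreal (norm (wavelet \<alpha> \<phi> a x y)) \<le> ennreal (k * a powr - h) * T a x y"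
    if a: "0 < a" and x: "x \<in> upper_half_space" and y: "y \<in> upper_half_space" for a x y
  proof -
    have "wavelet \<alpha> \<phi> a x y = wavelet \<alpha> u a x y"
      unfolding u_def by (rule wavelet_zero_extension[OF a x y])
    moreover have "ennreal (norm (wavelet \<alpha> u a x y)) = ennreal (a powr h) * ennreal (norm (gen_translation \<alpha> x (dilation \<alpha> a u) y))"
      by (simp add: wavelet_def h_def ennreal_mult)
    ultimately have "ennreal (norm (wavelet \<alpha> \<phi> a x y)) = ennreal (a powr h) * ennreal (norm (gen_translation \<alpha> x (dilation \<alpha> a u) y))"
      by (simp only:)
    also have "\<dots> \<le> ennreal (a powr h) * (ennreal k *
        (\<integral>\<^sup>+\<theta>. ennreal (norm (dilation \<alpha> a u (translate_arg x y \<theta>))) * ennreal (sin \<theta> powr (2 * \<alpha>)) * indicator {0..pi} \<theta> \<partial>lborel))"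
      unfolding k_def by (intro mult_left_mono norm_gen_translation_le) simp
    also have "(\<integral>\<^sup>+\<theta>. ennreal (norm (dilation \<alpha> a u (translate_arg x y \<theta>))) * ennreal (sin \<theta> powr (2 * \<alpha>)) * indicator {0..pi} \<theta> \<partial>lborel)
        = (\<integral>\<^sup>+\<theta>. ennreal (a powr - (2 * h)) * (ennreal (norm (u (translate_arg x y \<theta> /\<^sub>R a))) * ennreal (sin \<theta> powr (2 * \<alpha>)) * indicator {0..pi} \<theta>) \<partial>lborel)"
      by (intro nn_integral_cong) (simp add: dilation_def h_def ennreal_mult mult.assoc algebra_simps)
    also have "\<dots> = ennreal (a powr - (2 * h)) * T a x y"
      unfolding T_def by (rule nn_integral_cmult) measurable
    also have "ennreal (a powr h) * (ennreal k * (ennreal (a powr - (2 * h)) * T a x y))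
        = ennreal (a powr h * (k * a powr - (2 * h))) * T a x y"
      using k by (simp add: ennreal_mult mult.assoc)
    also have "a powr h * (k * a powr - (2 * h)) = k * (a powr h * a powr - (2 * h))" by simp
    also have "\<dots> = k * a powr - h" by (simp only: powr_add[symmetric]) simp
    finally show ?thesis .
  qed
  have T_meas: "T a x \<in> borel_measurable ?W" for a x
    by (rule measurable_weinstein_measure_borel) (unfold T_def, measurable)
  define B where "B = k * I * b1 + k * I * b"
  show thesis
  proof (rule that[of B])
    show "0 \<le> B" using k I b1 b by (simp add: B_def)
  next
    fix a :: real and x :: "(real ^ 'd) \<times> real" assume a: "0 < a" and x: "x \<in> upper_half_space"
    have "(\<integral>\<^sup>+y. ennreal (norm (wavelet \<alpha> \<phi> a x y)) \<partial>?W) \<le> (\<integral>\<^sup>+y. ennreal (k * a powr - h) * T a x y \<partial>?W)"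
      by (intro nn_integral_mono wavelet_le a x) simp
    also have "\<dots> = ennreal (k * a powr - h) * (\<integral>\<^sup>+y. T a x y \<partial>?W)"
      by (rule nn_integral_cmult[OF T_meas])
    also have "(\<integral>\<^sup>+y. T a x y \<partial>?W) = ennreal I * (\<integral>\<^sup>+y. ennreal (norm (u (y /\<^sub>R a))) \<partial>?W)"
      unfolding T_def I(1)[symmetric] by (rule nn_integral_weinstein_translation) measurable
    also have "(\<integral>\<^sup>+y. ennreal (norm (u (y /\<^sub>R a))) \<partial>?W) = ennreal (a powr (2 * \<alpha> + real CARD('d) + 2)) * ennreal b1"
      unfolding b1(2)[symmetric] by (rule nn_integral_weinstein_dilation[OF _ a]) measurable
    also have "2 * \<alpha> + real CARD('d) + 2 = 2 * h" by (simp add: h_def)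
    also have "ennreal (k * a powr - h) * (ennreal I * (ennreal (a powr (2 * h)) * ennreal b1))
        = ennreal (k * a powr - h * (I * (a powr (2 * h) * b1)))"
      using k I b1 by (simp add: ennreal_mult[symmetric])
    also have "k * a powr - h * (I * (a powr (2 * h) * b1)) = (k * I * b1) * (a powr - h * a powr (2 * h))"
      by simp
    also have "\<dots> = (k * I * b1) * a powr h" by (simp only: powr_add[symmetric]) simp
    also have "ennreal \<dots> \<le> ennreal (B * a powr h)"
      using k I b by (intro ennreal_leI mult_right_mono) (auto simp: B_def)
    finally show "(\<integral>\<^sup>+y. ennreal (norm (wavelet \<alpha> \<phi> a x y)) \<partial>?W) \<le> ennreal (B * a powr (\<alpha> + 1 + real CARD('d) / 2))"
      unfolding h_def .
  next
    fix a :: real and x :: "(real ^ 'd) \<times> real" assume a: "0 < a" and x: "x \<in> upper_half_space"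
    \<comment> \<open>The exceptional set of the bound \<open>\<bar>u\<bar> \<le> b\<close>, which the translation integrates to zero.\<close>
    define e where "e z = (if norm (u z) \<le> b then 0 else 1 :: ennreal)" for z
    have [measurable]: "e \<in> borel_measurable borel" unfolding e_def by measurable
    have e_W: "e \<in> borel_measurable ?W" by (rule measurable_weinstein_measure_borel) measurable
    let ?E = "\<lambda>y. \<integral>\<^sup>+\<theta>. e (translate_arg x y \<theta> /\<^sub>R a) * ennreal (sin \<theta> powr (2 * \<alpha>)) * indicator {0..pi} \<theta> \<partial>lborel"
    have "(\<integral>\<^sup>+y. ?E y \<partial>?W) = sin_powr_integral \<alpha> * (\<integral>\<^sup>+y. e (y /\<^sub>R a) \<partial>?W)"
      by (rule nn_integral_weinstein_translation[where u="\<lambda>z. e (z /\<^sub>R a)"]) measurable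
    also have "(\<integral>\<^sup>+y. e (y /\<^sub>R a) \<partial>?W) = ennreal (a powr (2 * \<alpha> + real CARD('d) + 2)) * (\<integral>\<^sup>+y. e y \<partial>?W)"
      by (rule nn_integral_weinstein_dilation[OF _ a]) measurable
    also have "(\<integral>\<^sup>+y. e y \<partial>?W) = 0"
      using b(2) by (subst nn_integral_0_iff_AE[OF e_W]) (auto simp: e_def)
    finally have "(\<integral>\<^sup>+y. ?E y \<partial>?W) = 0" by simp
    moreover have "?E \<in> borel_measurable ?W"
      by (rule measurable_weinstein_measure_borel) measurable
    ultimately have "AE y in ?W. ?E y = 0" by (simp add: nn_integral_0_iff_AE)
    then show "AE y in ?W. norm (wavelet \<alpha> \<phi> a x y) \<le> B / a powr (\<alpha> + 1 + real CARD('d) / 2)"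
      using AE_space
    proof eventually_elim
      case (elim y)
      have "AE \<theta> in lborel. e (translate_arg x y \<theta> /\<^sub>R a) * ennreal (sin \<theta> powr (2 * \<alpha>)) * indicator {0..pi} \<theta> = 0"
        using elim(1) by (subst (asm) nn_integral_0_iff_AE) measurable
      then have "AE \<theta> in lborel. ennreal (norm (u (translate_arg x y \<theta> /\<^sub>R a))) * ennreal (sin \<theta> powr (2 * \<alpha>)) * indicator {0..pi} \<theta>
          \<le> ennreal b * (ennreal (sin \<theta> powr (2 * \<alpha>)) * indicator {0..pi} \<theta>)"
      proof eventually_elim
        case (elim \<theta>)
        show ?case
        proof (cases "norm (u (translate_arg x y \<theta> /\<^sub>R a)) \<le> b")
          case True
          then show ?thesis unfolding mult.assoc by (intro mult_right_mono ennreal_leI) auto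
        next
          case False
          then have "ennreal (sin \<theta> powr (2 * \<alpha>)) * indicator {0..pi} \<theta> = 0"
            using elim by (simp add: e_def)
          then show ?thesis by (simp only: mult.assoc mult_zero_right order_refl)
        qed
      qed
      then have "T a x y \<le> (\<integral>\<^sup>+\<theta>. ennreal b * (ennreal (sin \<theta> powr (2 * \<alpha>)) * indicator {0..pi} \<theta>) \<partial>lborel)"
        unfolding T_def by (rule nn_integral_mono_AE)
      also have "\<dots> = ennreal b * ennreal I"
        unfolding I(1)[symmetric] sin_powr_integral_def by (rule nn_integral_cmult) measurable
      finally have "ennreal (k * a powr - h) * T a x y \<le> ennreal (k * a powr - h) * (ennreal b * ennreal I)"
        by (rule mult_left_mono) simp
      also have "\<dots> = ennreal (k * I * b * a powr - h)"
        using k I b by (simp add: ennreal_mult[symmetric] mult_ac)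
      also have "\<dots> \<le> ennreal (B * a powr - h)"
        using k I b1 by (intro ennreal_leI mult_right_mono) (auto simp: B_def)
      finally have T_le: "ennreal (k * a powr - h) * T a x y \<le> ennreal (B * a powr - h)" .
      have "ennreal (norm (wavelet \<alpha> \<phi> a x y)) \<le> ennreal (B * a powr - h)"
        by (rule order_trans[OF wavelet_le[OF a x] T_le]) (use elim(2) in simp)
      moreover have "0 \<le> B" using k I b1 b by (simp add: B_def)
      ultimately have "norm (wavelet \<alpha> \<phi> a x y) \<le> B * a powr - h" by simp
      then show ?case unfolding h_def[symmetric] by (simp only: powr_minus divide_inverse)
    qed
  qed
qed

lemma window_family_wavelet:
  fixes \<phi> :: "(real ^ 'd) \<times> real \<Rightarrow> complex"
  assumes \<alpha>: "\<alpha> > - 1 / 2"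
    and \<phi>: "\<phi> \<in> Lp_space (weinstein_measure \<alpha>) 1 \<inter> Lp_space (weinstein_measure \<alpha>) \<infinity>"
  obtains B0 where "\<And>B. B0 < B \<Longrightarrow> window_family (weinstein_measure \<alpha>) (weinstein_measure_X \<alpha>)
      (\<lambda>w y. wavelet \<alpha> \<phi> (fst w) (snd w) y) (\<lambda>w. fst w powr (\<alpha> + 1 + real CARD('d) / 2)) B"
proof -
  let ?h = "\<alpha> + 1 + real CARD('d) / 2"
  obtain B0 where B0: "0 \<le> B0"
    "\<And>a x. 0 < a \<Longrightarrow> x \<in> upper_half_space \<Longrightarrow>
      (\<integral>\<^sup>+y. ennreal (norm (wavelet \<alpha> \<phi> a x y)) \<partial>weinstein_measure \<alpha>) \<le> ennreal (B0 * a powr ?h)"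
    "\<And>a x. 0 < a \<Longrightarrow> x \<in> upper_half_space \<Longrightarrow>
      AE y in weinstein_measure \<alpha>. norm (wavelet \<alpha> \<phi> a x y) \<le> B0 / a powr ?h"
    using wavelet_bounds[OF assms] by metis
  show thesis
  proof (rule that[of B0])
    fix B assume "B0 < B"
    show "window_family (weinstein_measure \<alpha>) (weinstein_measure_X \<alpha>)
      (\<lambda>w y. wavelet \<alpha> \<phi> (fst w) (snd w) y) (\<lambda>w. fst w powr ?h) B"
    proof (intro window_family.intro window_family_axioms.intro sigma_finite_weinstein_measure sigma_finite_weinstein_measure_X)
      show "(\<lambda>(w, z). wavelet \<alpha> \<phi> (fst w) (snd w) z) \<in> borel_measurable (weinstein_measure_X \<alpha> \<Otimes>\<^sub>M weinstein_measure \<alpha>)"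
        using \<phi> by (intro wavelet_measurable Lp_space_measurable) auto
      show "(\<lambda>w. fst w powr ?h) \<in> borel_measurable (weinstein_measure_X \<alpha> :: (real \<times> ((real ^ 'd) \<times> real)) measure)"
        unfolding measurable_cong_sets[OF sets_weinstein_measure_X refl]
        by (rule measurable_compose[OF measurable_fst measurable_restrict_space1]) measurable
      show "0 < B" using B0(1) \<open>B0 < B\<close> by simp
      fix w :: "real \<times> ((real ^ 'd) \<times> real)" assume "w \<in> space (weinstein_measure_X \<alpha>)"
      then have w: "0 < fst w" "snd w \<in> upper_half_space"
        by (auto simp: space_weinstein_measure_X)
      show "0 < fst w powr ?h" using w by simp
      show "(\<integral>\<^sup>+z. ennreal (norm (wavelet \<alpha> \<phi> (fst w) (snd w) z)) \<partial>weinstein_measure \<alpha>) \<le> ennreal (B * fst w powr ?h)"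
        using \<open>B0 < B\<close> by (intro order_trans[OF B0(2)[OF w]] ennreal_leI mult_right_mono) auto
      show "AE z in weinstein_measure \<alpha>. norm (wavelet \<alpha> \<phi> (fst w) (snd w) z) \<le> B / fst w powr ?h"
        using B0(3)[OF w]
      proof eventually_elim
        case (elim z)
        also have "B0 / fst w powr ?h \<le> B / fst w powr ?h"
          using \<open>B0 < B\<close> by (intro divide_right_mono) auto
        finally show ?case .
      qed
    qed
  qed
qed

theorem theorem3p11:
  fixes \<alpha> :: real
    and \<phi> \<psi> :: "(real ^ 'd) \<times> real \<Rightarrow> complex"
    and \<sigma> :: "real \<times> ((real ^ 'd) \<times> real) \<Rightarrow> complex"
    and p :: ennreal
  assumes "\<alpha> > - 1 / 2"
    and "\<phi> \<in> Lp_space (weinstein_measure \<alpha>) 1 \<inter> Lp_space (weinstein_measure \<alpha>) \<infinity>"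
    and "\<psi> \<in> Lp_space (weinstein_measure \<alpha>) 1 \<inter> Lp_space (weinstein_measure \<alpha>) \<infinity>"
    and "\<sigma> \<in> Lp_space (weinstein_measure_X \<alpha>) 1"
    and "1 \<le> p"
  shows "compact_operator_Lp (weinstein_measure \<alpha>) p (localization_operator \<alpha> \<phi> \<psi> \<sigma>)"
proof -
  let ?W = "weinstein_measure \<alpha> :: ((real ^ 'd) \<times> real) measure"
  let ?X = "weinstein_measure_X \<alpha> :: (real \<times> ((real ^ 'd) \<times> real)) measure"
  let ?\<Phi> = "\<lambda>w y. wavelet \<alpha> \<phi> (fst w) (snd w) y"
  let ?\<Psi> = "\<lambda>w y. wavelet \<alpha> \<psi> (fst w) (snd w) y"
  let ?A = "\<lambda>w :: real \<times> ((real ^ 'd) \<times> real). fst w powr (\<alpha> + 1 + real CARD('d) / 2)"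
  obtain B1 where B1: "\<And>B. B1 < B \<Longrightarrow> window_family ?W ?X ?\<Phi> ?A B"
    using window_family_wavelet[OF assms(1,2)] by blast
  obtain B2 where B2: "\<And>B. B2 < B \<Longrightarrow> window_family ?W ?X ?\<Psi> ?A B"
    using window_family_wavelet[OF assms(1,3)] by blast
  have "integrable ?X (\<lambda>w. norm (\<sigma> w))" "\<sigma> \<in> borel_measurable ?X"
    using Lp_space_finite_integrable[OF assms(4)] Lp_space_measurable[OF assms(4)] by simp_all
  then have \<sigma>: "integrable ?X \<sigma>" by (rule integrable_norm_cancel)
  interpret two_window_localization ?W ?X ?\<Phi> ?\<Psi> ?A "max B1 B2 + 1" \<sigma>
    by (intro two_window_localization.intro two_window_localization_axioms.intro B1 B2 \<sigma>) auto
  have "localization_operator \<alpha> \<phi> \<psi> \<sigma> = (\<lambda>f. synthesis (analysis f))"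
    by (intro ext) (simp add: localization_operator_def wavelet_transform_def synthesis_def
        analysis_def case_prod_beta')
  moreover have "compact_operator_Lp ?W p (\<lambda>f. synthesis (analysis f))"
    by (intro compact_operator countably_generated_weinstein_measure
        countably_generated_weinstein_measure_X assms(5))
  ultimately show ?thesis by simp
qed

end
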